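(* For $i=1,2$, let $k_i$ be a (commutative) field and $V_i$ a $k_i$-vector space with $\dim_{k_i}(V_i)\geq 3$. Let $U_i$ be a subset of $\mathbb P(V_i)$ for $i=1,2$, and assume that $U_i$ is $\mathcal S_i$-ample for some admissible set $\mathcal S_i$ of subsets of $\mathbb P^1(k_i)$ for $i=1,2$. Let $\sigma:U_1\xrightarrow{\sim}U_2$ and $\tau:\mathbb L(V_1)_{U_1}\xrightarrow{\sim}\mathbb L(V_2)_{U_2}$ be bijections such that for each $\ell\in\mathbb L(V_1)_{U_1}$ one has $\tau(\ell)_{U_2}=\sigma(\ell_{U_1})$. Then each such $(\sigma,\tau):(U_1,\mathbb L(V_1)_{U_1})\xrightarrow{\sim}(U_2,\mathbb L(V_2)_{U_2})$ uniquely extends to a collineation $(\tilde\sigma,\tilde\tau):(\mathbb P(V_1),\mathbb L(V_1))\xrightarrow{\sim}(\mathbb P(V_2),\mathbb L(V_2))$. In particular, there exist a field isomorphism $\mu:k_1\xrightarrow{\sim}k_2$ and a $\mu$-semilinear isomorphism of abelian groups $\lambda:(V_1,+)\xrightarrow{\sim}(V_2,+)$ that induces $(\sigma,\tau):(U_1,\mathbb L(V_1)_{U_1})\xrightarrow{\sim}(U_2,\mathbb L(V_2)_{U_2})$. Moreover, such an isomorphism $(\mu,\lambda)$ is unique up to scalar multiplication.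
   Context: For a vector space $V$ over a field $k$: $\mathbb P(V)=(V\setminus\{0\})/k^{\times}$; $\mathbb L(V)$ is the set of lines of $\mathbb P(V)$ (subsets $\mathbb P(W)$ with $W\subset V$ a $2$-dimensional subspace); $\mathbb P^1(k)=\mathbb P(k^2)$; $\bar x\in\mathbb P(V)$ is the class of $x\in V\setminus\{0\}$. For $U\subset\mathbb P(V)$ and $\ell\in\mathbb L(V)$, $\ell_U=\ell\cap U$, $\ell_{U^c}=\ell\setminus\ell_U$, and $\mathbb L(V)_U=\{\ell\in\mathbb L(V)\mid\ell_U\neq\varnothing\}$. A set $\mathcal S$ of subsets of $\mathbb P^1(k)$ is $\mathrm{PGL}_2$-stable if $\gamma(S)\in\mathcal S$ for all $S\in\mathcal S$, $\gamma\in\mathrm{PGL}_2(k)$. It is $(m,n)$-admissible (integers $m,n\geq0$) if it is $\mathrm{PGL}_2$-stable and for all $0\leq m'\leq m$, $0\leq n'\leq n$, $S_1,\dots,S_{m'}\in\mathcal S$, $p_1,\dots,p_{n'}\in\mathbb P^1(k)$ one has $S_1\cup\dots\cup S_{m'}\cup\{p_1,\dots,p_{n'}\}\subsetneq\mathbb P^1(k)$. It is admissible if it is $(m,n)$-admissible for all integers $m,n\geq0$. For a $\mathrm{PGL}_2$-stable $\mathcal S$ and a $1$-dimensional projective space $\ell$ over $k$, $\mathcal S_\ell=\{S\subset\ell\mid\beta(S)\in\mathcal S\text{ for some (equivalently, every) }k\text{-projective isomorphism }\beta:\ell\to\mathbb P^1(k)\}$. A subset $U\subset\mathbb P(V)$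 is $\mathcal S$-ample if $U\neq\varnothing$ and, for each $\ell\in\mathbb L(V)$, either $\ell_U=\varnothing$ or $\ell_{U^c}\in\mathcal S_\ell$. A collineation $(\mathbb P(V_1),\mathbb L(V_1))\xrightarrow{\sim}(\mathbb P(V_2),\mathbb L(V_2))$ is a pair $(\tilde\sigma,\tilde\tau)$ of bijections $\tilde\sigma:\mathbb P(V_1)\to\mathbb P(V_2)$, $\tilde\tau:\mathbb L(V_1)\to\mathbb L(V_2)$ with $\tilde\tau(\ell)=\tilde\sigma(\ell)$ for all $\ell\in\mathbb L(V_1)$. $\lambda$ is $\mu$-semilinear if $\lambda(ax)=\mu(a)\lambda(x)$ for $a\in k_1$, $x\in V_1$. Such $(\mu,\lambda)$ induces a collineation by $\bar x\mapsto\overline{\lambda(x)}$; it induces $(\sigma,\tau)$ if this collineation restricts to $(\sigma,\tau)$. Unique up to scalar multiplication: if $(\mu,\lambda)$ and $(\mu',\lambda')$ both induce $(\sigma,\tau)$, then $\mu'=\mu$ and there is $a\in k_1^\times$ with $\lambda'(x)=\lambda(ax)$ for all $x$. *)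

theory Defs
  imports "HOL-Analysis.Cartesian_Space"
begin

text \<open>
  A vector space over a field is given by its scalar multiplication
  \<open>scl :: 'k::field \<Rightarrow> 'v::ab_group_add \<Rightarrow> 'v\<close> satisfying \<^locale>\<open>vector_space\<close>; the space is the
  whole type \<open>'v\<close>. Points of a projective space are classes of nonzero vectors, and lines are sets
  of points.
\<close>

text \<open>\<open>vector_space.dim\<close> is \<open>0\<close> on infinite-dimensional spaces, so it cannot be used here.\<close>

definition dim_ge :: "('k::field \<Rightarrow> 'v::ab_group_add \<Rightarrow> 'v) \<Rightarrow> nat \<Rightarrow> bool" where
  "dim_ge scl n \<longleftrightarrow>
     (\<exists>B. \<not> module.dependent scl B \<and> module.span scl B = UNIV \<and> (infinite B \<or> n \<le> card B))"

definition proj_point :: "('k::field \<Rightarrow> 'v::ab_group_add \<Rightarrow> 'v) \<Rightarrow> 'v \<Rightarrow> 'v set" where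
  "proj_point scl x = {scl a x | a. a \<noteq> 0}"

definition proj_space :: "('k::field \<Rightarrow> 'v::ab_group_add \<Rightarrow> 'v) \<Rightarrow> 'v set \<Rightarrow> 'v set set" where
  "proj_space scl W = proj_point scl ` (W - {0})"

definition proj_lines :: "('k::field \<Rightarrow> 'v::ab_group_add \<Rightarrow> 'v) \<Rightarrow> 'v set set set" where
  "proj_lines scl =
     {proj_space scl W | W. module.subspace scl W \<and> vector_space.dim scl W = 2}"

definition proj_lines_meeting ::
  "('k::field \<Rightarrow> 'v::ab_group_add \<Rightarrow> 'v) \<Rightarrow> 'v set set \<Rightarrow> 'v set set set" where
  "proj_lines_meeting scl U = {l \<in> proj_lines scl. l \<inter> U \<noteq> {}}"

definition P1 :: "('k::field ^ 2) set set" where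
  "P1 = proj_space (*s) UNIV"

text \<open>
  An element of \<open>PGL\<^sub>2(k)\<close> acts on points through any invertible matrix representing it; the image
  of the class of \<open>x\<close> under \<open>x \<mapsto> A *v x\<close> is the class of \<open>A *v x\<close>.
\<close>

definition PGL2 :: "(('k::field ^ 2) set \<Rightarrow> ('k ^ 2) set) set" where
  "PGL2 = {(`) ((*v) A) | A :: 'k ^ 2 ^ 2. invertible A}"

definition PGL2_stable :: "('k::field ^ 2) set set set \<Rightarrow> bool" where
  "PGL2_stable \<S> \<longleftrightarrow> \<S> \<subseteq> Pow P1 \<and> (\<forall>S\<in>\<S>. \<forall>\<gamma>\<in>PGL2. \<gamma> ` S \<in> \<S>)"

definition mn_admissible :: "nat \<Rightarrow> nat \<Rightarrow> ('k::field ^ 2) set set set \<Rightarrow> bool" where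
  "mn_admissible m n \<S> \<longleftrightarrow> PGL2_stable \<S> \<and>
     (\<forall>m'\<le>m. \<forall>n'\<le>n. \<forall>S p. (\<forall>i<m'. S i \<in> \<S>) \<and> (\<forall>j<n'. p j \<in> P1) \<longrightarrow>
        (\<Union>i<m'. S i) \<union> {p j | j. j < n'} \<subset> P1)"

definition admissible :: "('k::field ^ 2) set set set \<Rightarrow> bool" where
  "admissible \<S> \<longleftrightarrow> (\<forall>m n. mn_admissible m n \<S>)"

text \<open>
  \<open>\<beta>\<close> restricts to an isomorphism of projective spaces from \<open>\<P>(W)\<close> to \<open>\<P>(W')\<close>, that is, to
  the map induced by a linear isomorphism \<open>f\<close> from the subspace \<open>W\<close> to the subspace \<open>W'\<close>.
\<close>

definition proj_iso ::
  "('k::field \<Rightarrow> 'v::ab_group_add \<Rightarrow> 'v) \<Rightarrow> 'v set \<Rightarrow>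
   ('k \<Rightarrow> 'w::ab_group_add \<Rightarrow> 'w) \<Rightarrow> 'w set \<Rightarrow> ('v set \<Rightarrow> 'w set) \<Rightarrow> bool" where
  "proj_iso scl W scl' W' \<beta> \<longleftrightarrow>
     (\<exists>f. bij_betw f W W' \<and>
          (\<forall>x\<in>W. \<forall>y\<in>W. f (x + y) = f x + f y) \<and>
          (\<forall>a. \<forall>x\<in>W. f (scl a x) = scl' a (f x)) \<and>
          (\<forall>x\<in>W - {0}. \<beta> (proj_point scl x) = proj_point scl' (f x)))"

text \<open>The family \<open>\<S>\<^sub>l\<close> transported to a line \<open>l\<close>.\<close>

definition transport ::
  "('k::field ^ 2) set set set \<Rightarrow> ('k \<Rightarrow> 'v::ab_group_add \<Rightarrow> 'v) \<Rightarrow> 'v set set \<Rightarrow> 'v set set set" where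
  "transport \<S> scl l =
     {S. S \<subseteq> l \<and>
         (\<exists>W \<beta>. module.subspace scl W \<and> l = proj_space scl W \<and>
                proj_iso scl W (*s) UNIV \<beta> \<and> \<beta> ` S \<in> \<S>)}"

definition ample ::
  "('k::field ^ 2) set set set \<Rightarrow> ('k \<Rightarrow> 'v::ab_group_add \<Rightarrow> 'v) \<Rightarrow> 'v set set \<Rightarrow> bool" where
  "ample \<S> scl U \<longleftrightarrow> U \<subseteq> proj_space scl UNIV \<and> U \<noteq> {} \<and>
     (\<forall>l\<in>proj_lines scl. l \<inter> U = {} \<or> l - U \<in> transport \<S> scl l)"

text \<open>
  Maps between projective spaces are represented by total functions of which only the values on
  the relevant points and lines matter.
\<close>

definition collineation ::
  "('k1::field \<Rightarrow> 'v1::ab_group_add \<Rightarrow> 'v1) \<Rightarrow> ('k2::field \<Rightarrow> 'v2::ab_group_add \<Rightarrow> 'v2) \<Rightarrow>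
   ('v1 set \<Rightarrow> 'v2 set) \<Rightarrow> ('v1 set set \<Rightarrow> 'v2 set set) \<Rightarrow> bool" where
  "collineation scale1 scale2 \<sigma> \<tau> \<longleftrightarrow>
     bij_betw \<sigma> (proj_space scale1 UNIV) (proj_space scale2 UNIV) \<and>
     bij_betw \<tau> (proj_lines scale1) (proj_lines scale2) \<and>
     (\<forall>l\<in>proj_lines scale1. \<tau> l = \<sigma> ` l)"

definition extends ::
  "('k1::field \<Rightarrow> 'v1::ab_group_add \<Rightarrow> 'v1) \<Rightarrow> 'v1 set set \<Rightarrow>
   ('v1 set \<Rightarrow> 'v2 set) \<Rightarrow> ('v1 set set \<Rightarrow> 'v2 set set) \<Rightarrow>
   ('v1 set \<Rightarrow> 'v2 set) \<Rightarrow> ('v1 set set \<Rightarrow> 'v2 set set) \<Rightarrow> bool" where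
  "extends scale1 U1 \<sigma> \<tau> \<sigma>' \<tau>' \<longleftrightarrow>
     (\<forall>p\<in>U1. \<sigma>' p = \<sigma> p) \<and> (\<forall>l\<in>proj_lines_meeting scale1 U1. \<tau>' l = \<tau> l)"

definition field_iso :: "('k1::field \<Rightarrow> 'k2::field) \<Rightarrow> bool" where
  "field_iso \<mu> \<longleftrightarrow> bij \<mu> \<and> \<mu> 1 = 1 \<and>
     (\<forall>a b. \<mu> (a + b) = \<mu> a + \<mu> b) \<and> (\<forall>a b. \<mu> (a * b) = \<mu> a * \<mu> b)"

definition semilinear_iso ::
  "('k1::field \<Rightarrow> 'v1::ab_group_add \<Rightarrow> 'v1) \<Rightarrow> ('k2::field \<Rightarrow> 'v2::ab_group_add \<Rightarrow> 'v2) \<Rightarrow>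
   ('k1 \<Rightarrow> 'k2) \<Rightarrow> ('v1 \<Rightarrow> 'v2) \<Rightarrow> bool" where
  "semilinear_iso scale1 scale2 \<mu> h \<longleftrightarrow> field_iso \<mu> \<and> bij h \<and>
     (\<forall>x y. h (x + y) = h x + h y) \<and> (\<forall>a x. h (scale1 a x) = scale2 (\<mu> a) (h x))"

text \<open>
  A semilinear isomorphism \<open>h\<close> induces \<open>(\<sigma>, \<tau>)\<close> if the collineation sending the class of \<open>x\<close> to the
  class of \<open>h x\<close> restricts to \<open>(\<sigma>, \<tau>)\<close>.
\<close>

definition induces ::
  "('k1::field \<Rightarrow> 'v1::ab_group_add \<Rightarrow> 'v1) \<Rightarrow> ('k2::field \<Rightarrow> 'v2::ab_group_add \<Rightarrow> 'v2) \<Rightarrow>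
   'v1 set set \<Rightarrow> ('v1 \<Rightarrow> 'v2) \<Rightarrow> ('v1 set \<Rightarrow> 'v2 set) \<Rightarrow> ('v1 set set \<Rightarrow> 'v2 set set) \<Rightarrow> bool" where
  "induces scale1 scale2 U1 h \<sigma> \<tau> \<longleftrightarrow>
     (\<exists>\<sigma>' \<tau>'. collineation scale1 scale2 \<sigma>' \<tau>' \<and>
        (\<forall>x. x \<noteq> 0 \<longrightarrow> \<sigma>' (proj_point scale1 x) = proj_point scale2 (h x)) \<and>
        extends scale1 U1 \<sigma> \<tau> \<sigma>' \<tau>')"

end

theory Submission
  imports Defs
begin

text \<open>
The partial map \<open>\<sigma>\<close> can be lifted directly to a semilinear map \<open>\<Lambda>\<close> of the whole vector space; the
collineation extending \<open>(\<sigma>, \<tau>)\<close> is then the one induced by \<open>\<Lambda>\<close>. This way the images of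
the points outside the ample set need not be constructed one by one as intersections of lines.

Let \<open>X\<close> be the cone of nonzero vectors whose class lies in the ample set \<open>U\<close>. On an affine line
\<open>{v + t u}\<close> off the origin with direction \<open>u \<in> X\<close>, the parameters \<open>t\<close> with
\<open>v + t u \<notin> X\<close> correspond to points of the complement of \<open>U\<close> on a projective line meeting \<open>U\<close>, hence lie
in a member of the admissible family. Finitely many such sets and finitely many points do not
exhaust \<open>\<P>\<^sup>1\<close>, so finitely many given vectors can be moved into \<open>X\<close> simultaneously by one generic
translation, which moreover avoids prescribed proper subspaces (locale \<open>ample_cone\<close>, lemmas
\<open>ample_cone_of_ample\<close> and \<open>generic_vector\<close>).

The compatibility of \<open>\<sigma>\<close> and \<open>\<tau>\<close> says that representatives \<open>s x\<close> of \<open>\<sigma>\<close> preserve and reflect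
collinearity on \<open>X\<close> (locale \<open>cone_map\<close>). Fix \<open>e \<in> X\<close>. When \<open>x\<close> and \<open>x + e\<close> lie in \<open>X\<close> and \<open>x\<close> is not a
multiple of \<open>e\<close>, the line through the classes of \<open>x\<close>, \<open>e\<close> and \<open>x + e\<close> singles out one representative
\<open>y\<close> of \<open>\<sigma>\<close> at \<open>x\<close>, namely the one for which \<open>y + s e\<close> represents \<open>\<sigma>\<close> at \<open>x + e\<close>. The parallelogram
construction shows that this choice is additive as far as it is defined, and writing an arbitrary
vector as a difference of two generic ones extends it to an additive map \<open>\<Lambda>\<close> on the whole space. For
\<open>x \<in> X\<close> the vector \<open>\<Lambda> x\<close> lies in all the planes spanned by \<open>s x\<close> and \<open>s g\<close> with \<open>g\<close> generic, so it
represents \<open>\<sigma>\<close> at \<open>x\<close> (\<open>lift_on_cone\<close>).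

The rest rests on one rigidity statement, \<open>proportional_on_cone_imp_proportional\<close>: an additive map
that is pointwise proportional on \<open>X\<close> to an additive map preserving independence is globally a constant
multiple of it. Applied to \<open>x \<mapsto> \<Lambda> (a x)\<close> it yields the semilinearity of \<open>\<Lambda>\<close>; applied to the
composites of \<open>\<Lambda>\<close> with the map \<open>\<Lambda>'\<close> obtained from \<open>\<sigma>\<^sup>-\<^sup>1\<close> it shows that these are nonzero scalars, so
\<open>\<Lambda>\<close> and its field homomorphism are bijective; applied to two semilinear maps inducing \<open>(\<sigma>, \<tau>)\<close> it
yields uniqueness up to a scalar. Finally, an extension to a collineation is determined at every
point because the point is the intersection of two lines meeting \<open>U\<close>.
\<close>

section \<open>Spans of two and three vectors\<close>

context vector_space
begin

no_notation scale (infixr "*s" 75)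
notation scale (infixr "\<cdot>" 75)

lemma span_pairE:
  assumes "z \<in> span {x, y}"
  obtains a b where "z = a \<cdot> x + b \<cdot> y"
  using assms by (force simp: span_breakdown_eq span_singleton diff_eq_eq algebra_simps)

lemma span_singletonE:
  assumes "y \<in> span {x}"
  obtains a where "y = a \<cdot> x"
  using assms by (auto simp: span_singleton)

lemma in_span_pair: "a \<cdot> x + b \<cdot> y \<in> span {x, y}"
  by (intro span_add span_scale span_base) auto

lemma in_span_scale_iff:
  assumes "a \<noteq> 0" "subspace S"
  shows "a \<cdot> x \<in> S \<longleftrightarrow> x \<in> S"
proof
  assume "a \<cdot> x \<in> S"
  then have "inverse a \<cdot> (a \<cdot> x) \<in> S" using assms subspace_scale by blast
  then show "x \<in> S" using assms by simp
qed (use assms subspace_scale in blast)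

lemma span_singleton_eq:
  assumes "y \<in> span {x}" "y \<noteq> 0"
  shows "span {y} = span {x}"
proof -
  obtain a where a: "y = a \<cdot> x" using assms(1) by (rule span_singletonE)
  then have "a \<noteq> 0" using assms(2) by auto
  then have "x = inverse a \<cdot> y" using a by simp
  then have "x \<in> span {y}" by (metis span_base span_scale singletonI)
  then show ?thesis using assms(1) by (simp add: span_eq)
qed

lemma independent_pair_coeffs:
  assumes "x \<noteq> 0" "y \<notin> span {x}" "a \<cdot> x + b \<cdot> y = a' \<cdot> x + b' \<cdot> y"
  shows "a = a'" "b = b'"
proof -
  have e: "(b - b') \<cdot> y = (a' - a) \<cdot> x"
    using assms(3) by (simp add: scale_left_diff_distrib algebra_simps)
  have "(b - b') \<cdot> y \<in> span {x}" unfolding e by (intro span_scale span_base) simp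
  then show b: "b = b'" using in_span_scale_iff[OF _ subspace_span] assms(2) by (cases "b = b'") auto
  show "a = a'" using e assms(1) b by simp
qed

lemma independent_triple_coeffs:
  assumes "x \<noteq> 0" "y \<notin> span {x}" "z \<notin> span {x, y}"
    and "a \<cdot> x + b \<cdot> y + c \<cdot> z = a' \<cdot> x + b' \<cdot> y + c' \<cdot> z"
  shows "a = a'" "b = b'" "c = c'"
proof -
  have e: "(c - c') \<cdot> z = (a' - a) \<cdot> x + (b' - b) \<cdot> y"
    using assms(4) by (simp add: scale_left_diff_distrib algebra_simps)
  have "(c - c') \<cdot> z \<in> span {x, y}" unfolding e by (rule in_span_pair)
  then show c: "c = c'" using in_span_scale_iff[OF _ subspace_span] assms(3) by (cases "c = c'") auto
  have "a \<cdot> x + b \<cdot> y = a' \<cdot> x + b' \<cdot> y" using assms(4) c by simp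
  then show "a = a'" "b = b'" using independent_pair_coeffs assms by blast+
qed

lemma span_pair_eq:
  assumes "x \<noteq> 0" "y \<notin> span {x}" "x \<in> span {u, v}" "y \<in> span {u, v}"
  shows "span {x, y} = span {u, v}"
proof
  show "span {x, y} \<subseteq> span {u, v}" using assms(3,4) by (intro span_minimal) auto
  obtain a b where x: "x = a \<cdot> u + b \<cdot> v" using assms(3) by (rule span_pairE)
  obtain c d where y: "y = c \<cdot> u + d \<cdot> v" using assms(4) by (rule span_pairE)
  let ?D = "a * d - b * c"
  have 1: "d \<cdot> x - b \<cdot> y = ?D \<cdot> u"
    by (simp add: x y scale_right_distrib scale_left_diff_distrib algebra_simps)
  have 2: "a \<cdot> y - c \<cdot> x = ?D \<cdot> v"
    by (simp add: x y scale_right_distrib scale_left_diff_distrib algebra_simps)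
  have m: "d \<cdot> x - b \<cdot> y \<in> span {x, y}" "a \<cdot> y - c \<cdot> x \<in> span {x, y}"
    by (intro span_diff span_scale span_base; simp)+
  have D: "?D \<noteq> 0"
  proof
    assume "?D = 0"
    then have "0 \<cdot> x + a \<cdot> y = c \<cdot> x + 0 \<cdot> y" "0 \<cdot> x + b \<cdot> y = d \<cdot> x + 0 \<cdot> y"
      using 1 2 by auto
    then have "a = 0" "b = 0" using independent_pair_coeffs assms(1,2) by blast+
    then show False using x assms(1) by simp
  qed
  have "u \<in> span {x, y}" "v \<in> span {x, y}"
    using m D unfolding 1 2 by (simp_all add: in_span_scale_iff)
  then show "span {u, v} \<subseteq> span {x, y}" by (intro span_minimal) auto
qed

lemma span_pair_cong:
  assumes "span {x} = span {x'}" "span {y} = span {y'}"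
  shows "span {x, y} = span {x', y'}"
proof -
  have "x \<in> span {x'}" "x' \<in> span {x}" "y \<in> span {y'}" "y' \<in> span {y}"
    using assms span_base by blast+
  moreover have "span {x} \<subseteq> span {x, y}" "span {y} \<subseteq> span {x, y}"
    "span {x'} \<subseteq> span {x', y'}" "span {y'} \<subseteq> span {x', y'}" by (intro span_mono; simp)+
  ultimately show ?thesis unfolding span_eq by blast
qed

lemma notin_span_translate:
  assumes "x \<notin> span {e}" "e \<noteq> 0"
  shows "e \<notin> span {x}" "e \<notin> span {x + e}" "x + e \<notin> span {x}"
proof -
  have bx: "x \<in> span {x}" "e \<in> span {e}" "x + e \<in> span {x + e}" by (simp_all add: span_base)
  show 1: "e \<notin> span {x}" using span_singleton_eq[of e x] assms bx by auto
  show "e \<notin> span {x + e}" using span_singleton_eq[of e "x + e"] assms bx span_add_eq2[of e "{e}" x] by auto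
  show "x + e \<notin> span {x}" using 1 bx span_add_eq[of x "{x}" e] by auto
qed

text \<open>
An affine line not contained in a subspace meets it at most once; this is what makes avoiding
subspaces a matter of excluding finitely many parameters.
\<close>

lemma finite_line_inter_subspace:
  assumes "subspace S" "c \<notin> S \<or> b \<notin> S"
  shows "finite {s. c + s \<cdot> b \<in> S}"
proof -
  have "s = s'" if "c + s \<cdot> b \<in> S" "c + s' \<cdot> b \<in> S" for s s'
  proof (rule ccontr)
    assume "s \<noteq> s'"
    have "(c + s \<cdot> b) - (c + s' \<cdot> b) \<in> S" using subspace_diff[OF assms(1)] that by blast
    then have "(s - s') \<cdot> b \<in> S" by (simp add: scale_left_diff_distrib)
    then have b: "b \<in> S" using in_span_scale_iff[OF _ assms(1)] \<open>s \<noteq> s'\<close> by auto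
    then have "(c + s \<cdot> b) - s \<cdot> b \<in> S"
      using that subspace_diff subspace_scale assms(1) by blast
    then show False using b assms(2) by simp
  qed
  then have "{s. c + s \<cdot> b \<in> S} \<subseteq> {s0}" if "c + s0 \<cdot> b \<in> S" for s0 using that by blast
  then show ?thesis by (cases "\<exists>s0. c + s0 \<cdot> b \<in> S") (auto intro: finite_subset)
qed

lemma dim_ge_3_imp_ex_notin_span_pair:
  assumes "dim_ge scale 3"
  shows "\<exists>v. v \<notin> span {x, y}"
proof (rule ccontr)
  assume "\<not> ?thesis"
  then have U: "span {x, y} = UNIV" by auto
  obtain B where B: "independent B" "infinite B \<or> 3 \<le> card B"
    using assms unfolding dim_ge_def by auto
  have "finite B \<and> card B \<le> card {x, y}" using independent_span_bound[of "{x, y}" B] B(1) U by auto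
  moreover have "card {x, y} \<le> 2" by (simp add: card_insert_if)
  ultimately show False using B(2) by auto
qed

end

section \<open>Generic vectors in an ample cone\<close>

text \<open>
\<open>generic_translate\<close> is the only trace of admissibility that the linear algebra uses: it allows
for arbitrary vectors in \<open>F\<close>, also multiples of \<open>u\<close>, and for a finite set \<open>T\<close> of forbidden parameters.
\<close>

locale ample_cone = vector_space scl
  for scl :: "'k::field \<Rightarrow> 'v::ab_group_add \<Rightarrow> 'v" (infixr "\<cdot>" 75) +
  fixes X :: "'v set"
  assumes zero_notin: "0 \<notin> X"
    and scale_in: "x \<in> X \<Longrightarrow> a \<noteq> 0 \<Longrightarrow> a \<cdot> x \<in> X"
    and cone_nonempty: "X \<noteq> {}"
    and ex_notin_span_pair: "\<exists>v. v \<notin> span {x, y}"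
    and generic_translate:
      "finite F \<Longrightarrow> finite T \<Longrightarrow> u \<in> X \<Longrightarrow> \<exists>t. t \<notin> T \<and> (\<forall>v\<in>F. v + t \<cdot> u \<in> X)"
begin

lemma infinite_scalars: "infinite (UNIV :: 'k set)"
proof
  assume "finite (UNIV :: 'k set)"
  then show False using generic_translate[of "{}" UNIV] cone_nonempty by blast
qed

text \<open>
First all \<open>h + c\<close> are moved off \<open>S\<close> and \<open>S'\<close> by a multiple of a vector outside both, then into \<open>X\<close> by
a multiple of a vector of \<open>X\<close>; for all but finitely many parameters the second translation stays off
both subspaces. Two subspaces are avoided at once because the lift built below has to stay away from
the line of its base vector as well as from a varying plane.
\<close>

lemma generic_vector:
  assumes S: "subspace S" "S \<noteq> UNIV" and S': "subspace S'" "S' \<noteq> UNIV" and C: "finite C"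
  shows "\<exists>h. \<forall>c\<in>C. h + c \<notin> S \<and> h + c \<notin> S' \<and> h + c \<in> X"
proof -
  obtain u where u: "u \<in> X" using cone_nonempty by auto
  obtain b1 b2 where b12: "b1 \<notin> S" "b2 \<notin> S'" using S(2) S'(2) by auto
  obtain b where b: "b \<notin> S" "b \<notin> S'"
  proof (cases "b1 \<in> S' \<and> b2 \<in> S")
    case True
    then have "b1 + b2 \<notin> S" "b1 + b2 \<notin> S'"
      using b12 subspace_diff[OF S(1), of "b1 + b2" b2] subspace_diff[OF S'(1), of "b1 + b2" b1]
      by auto
    then show ?thesis by (rule that)
  next
    case False
    then show ?thesis using b12 that by metis
  qed
  have "finite (\<Union>c\<in>C. {s. c + s \<cdot> b \<in> S} \<union> {s. c + s \<cdot> b \<in> S'})"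
    using C b S S' by (simp add: finite_line_inter_subspace)
  then obtain s where "s \<notin> (\<Union>c\<in>C. {s. c + s \<cdot> b \<in> S} \<union> {s. c + s \<cdot> b \<in> S'})"
    using ex_new_if_finite[OF infinite_scalars] by blast
  then have s: "c + s \<cdot> b \<notin> S" "c + s \<cdot> b \<notin> S'" if "c \<in> C" for c using that by auto
  let ?T = "\<Union>c\<in>C. {t. (c + s \<cdot> b) + t \<cdot> u \<in> S} \<union> {t. (c + s \<cdot> b) + t \<cdot> u \<in> S'}"
  have "finite ?T" using C s S S' by (simp add: finite_line_inter_subspace)
  then obtain t where "t \<notin> ?T" "\<forall>v\<in>(\<lambda>c. c + s \<cdot> b) ` C. v + t \<cdot> u \<in> X"
    using generic_translate[of "(\<lambda>c. c + s \<cdot> b) ` C" ?T u] C u by auto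
  then have "\<forall>c\<in>C. s \<cdot> b + t \<cdot> u + c \<notin> S \<and> s \<cdot> b + t \<cdot> u + c \<notin> S' \<and> s \<cdot> b + t \<cdot> u + c \<in> X"
    by (auto simp: algebra_simps)
  then show ?thesis by blast
qed

lemma generic_vector_span:
  assumes "finite C"
  obtains h where "\<forall>c\<in>C. h + c \<notin> span {x, y} \<and> h + c \<notin> span {x', y'} \<and> h + c \<in> X"
proof -
  have "span {x, y} \<noteq> UNIV" "span {x', y'} \<noteq> UNIV" using ex_notin_span_pair by blast+
  then show ?thesis using generic_vector[of "span {x, y}" "span {x', y'}" C] assms that by auto
qed

text \<open>
If \<open>x\<close>, \<open>y\<close> and \<open>x + y\<close> lie in \<open>X\<close> and \<open>x\<close>, \<open>y\<close> are independent, comparing coefficients in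
\<open>B (x + y) = B x + B y\<close> forces the factors at \<open>x\<close> and at \<open>y\<close> to agree. Arbitrary \<open>x\<close> and \<open>y\<close> in \<open>X\<close> are
linked through a generic third vector, and every vector is a difference of two elements of \<open>X\<close>.
\<close>

lemma proportional_on_cone_imp_proportional:
  fixes scl' :: "'l::field \<Rightarrow> 'w::ab_group_add \<Rightarrow> 'w"
  assumes W: "vector_space scl'"
    and A: "additive A" and B: "additive B"
    and pr: "\<And>x. x \<in> X \<Longrightarrow> \<exists>c. B x = scl' c (A x)"
    and nz: "\<And>x. x \<in> X \<Longrightarrow> A x \<noteq> 0"
    and indep: "\<And>x y. x \<in> X \<Longrightarrow> y \<in> X \<Longrightarrow> y \<notin> span {x} \<Longrightarrow> A y \<notin> module.span scl' {A x}"
  shows "\<exists>c. \<forall>x. B x = scl' c (A x)"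
proof -
  interpret W: vector_space scl' by fact
  obtain c where c: "\<And>x. x \<in> X \<Longrightarrow> B x = scl' (c x) (A x)" using pr by metis
  have indep_eq: "c x = c y" if "x \<in> X" "y \<in> X" "x + y \<in> X" "y \<notin> span {x}" for x y
  proof -
    have "B (x + y) = scl' (c (x + y)) (A x + A y)"
      using c[OF that(3)] additive.add[OF A] by simp
    moreover have "B (x + y) = scl' (c x) (A x) + scl' (c y) (A y)"
      using c that additive.add[OF B] by simp
    ultimately have "scl' (c x) (A x) + scl' (c y) (A y)
        = scl' (c (x + y)) (A x) + scl' (c (x + y)) (A y)"
      by (simp add: W.scale_right_distrib)
    then show ?thesis using W.independent_pair_coeffs[OF nz indep, of x y] that by metis
  qed
  have eq: "c x = c y" if xy: "x \<in> X" "y \<in> X" for x y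
  proof -
    obtain z where z: "\<forall>d\<in>{0, x, y}. z + d \<notin> span {x, y} \<and> z + d \<notin> span {x, y} \<and> z + d \<in> X"
      by (rule generic_vector_span[of "{0, x, y}" x y x y]) auto
    have "z \<notin> span {x, y}" "z \<in> X" "x + z \<in> X" "y + z \<in> X"
      using z by (auto simp: add.commute)
    moreover have "span {x} \<subseteq> span {x, y}" "span {y} \<subseteq> span {x, y}" by (intro span_mono; auto)+
    ultimately have "c x = c z" "c y = c z" using indep_eq xy by blast+
    then show ?thesis by simp
  qed
  obtain e where e: "e \<in> X" using cone_nonempty by auto
  have "B v = scl' (c e) (A v)" for v
  proof -
    obtain g where "\<forall>d\<in>{0, v}. g + d \<notin> span {e, e} \<and> g + d \<notin> span {e, e} \<and> g + d \<in> X"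
      by (rule generic_vector_span[of "{0, v}" e e e e]) auto
    then have g: "g \<in> X" "g + v \<in> X" by auto
    have "B v = B (g + v) - B g" using additive.add[OF B] by simp
    also have "\<dots> = scl' (c e) (A (g + v)) - scl' (c e) (A g)" using c eq e g by metis
    also have "\<dots> = scl' (c e) (A v)" by (simp add: additive.add[OF A] W.scale_right_distrib)
    finally show ?thesis .
  qed
  then show ?thesis by blast
qed

end

section \<open>The semilinear lift of a collinearity-preserving map\<close>

text \<open>
The vectors \<open>s x\<close> are arbitrary representatives of the image points, so \<open>s\<close> itself has no algebraic
property. Taking \<open>x = y\<close> in \<open>s_span_iff\<close> gives that \<open>s\<close> respects equality of points.
\<close>

locale cone_map = V1: ample_cone scl1 X + V2: vector_space scl2
  for scl1 :: "'k1::field \<Rightarrow> 'v1::ab_group_add \<Rightarrow> 'v1" (infixr "\<cdot>" 75)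
    and X :: "'v1 set"
    and scl2 :: "'k2::field \<Rightarrow> 'v2::ab_group_add \<Rightarrow> 'v2" (infixr "\<odot>" 75) +
  fixes s :: "'v1 \<Rightarrow> 'v2"
  assumes s_nonzero: "x \<in> X \<Longrightarrow> s x \<noteq> 0"
    and s_span_iff:
      "x \<in> X \<Longrightarrow> y \<in> X \<Longrightarrow> z \<in> X \<Longrightarrow> s z \<in> V2.span {s x, s y} \<longleftrightarrow> z \<in> V1.span {x, y}"
begin

lemma s_span_singleton_iff: "x \<in> X \<Longrightarrow> z \<in> X \<Longrightarrow> s z \<in> V2.span {s x} \<longleftrightarrow> z \<in> V1.span {x}"
  using s_span_iff[of x x z] by simp

end

locale based_cone_map = cone_map scl1 X scl2 s
  for scl1 :: "'k1::field \<Rightarrow> 'v1::ab_group_add \<Rightarrow> 'v1" (infixr "\<cdot>" 75)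
    and X :: "'v1 set"
    and scl2 :: "'k2::field \<Rightarrow> 'v2::ab_group_add \<Rightarrow> 'v2" (infixr "\<odot>" 75)
    and s :: "'v1 \<Rightarrow> 'v2" +
  fixes e :: 'v1
  assumes e_in: "e \<in> X"
begin

definition liftable :: "'v1 \<Rightarrow> bool" where
  "liftable x \<longleftrightarrow> x \<in> X \<and> x + e \<in> X \<and> x \<notin> V1.span {e}"

text \<open>
The normalisation of the representatives: among the multiples \<open>y\<close> of \<open>s x\<close>, the condition at \<open>x + e\<close>
fixes the scalar relative to the choice of \<open>s e\<close>.
\<close>

definition partial_lift :: "'v1 \<Rightarrow> 'v2" where
  "partial_lift x = (THE y. y \<in> V2.span {s x} \<and> y + s e \<in> V2.span {s (x + e)})"

text \<open>
By \<open>partial_lift_difference_eq\<close> the value does not depend on the chosen \<open>g\<close>.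
\<close>

definition lift :: "'v1 \<Rightarrow> 'v2" where
  "lift v = (let g = SOME g. liftable g \<and> liftable (g + v) in partial_lift (g + v) - partial_lift g)"

lemma e_nonzero: "e \<noteq> 0"
  using e_in V1.zero_notin by auto

text \<open>
The point of \<open>s (x + e)\<close> lies on the line through those of \<open>s x\<close> and \<open>s e\<close> and differs from both, so
rescaling its coefficient at \<open>s e\<close> to \<open>1\<close> gives \<open>y\<close>. Two solutions would differ by a vector common to
the distinct lines spanned by \<open>s x\<close> and \<open>s (x + e)\<close>.
\<close>

lemma ex1_partial_lift:
  assumes "liftable x"
  shows "\<exists>!y. y \<in> V2.span {s x} \<and> y + s e \<in> V2.span {s (x + e)}"
proof -
  have x: "x \<in> X" "x + e \<in> X" "x \<notin> V1.span {e}" using assms by (auto simp: liftable_def)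
  note n = V1.notin_span_translate[OF x(3) e_nonzero]
  have "x + e \<in> V1.span {x, e}" by (intro V1.span_add V1.span_base) auto
  then have "s (x + e) \<in> V2.span {s x, s e}" using s_span_iff x e_in by blast
  then obtain a b where ab: "s (x + e) = a \<odot> s x + b \<odot> s e" by (rule V2.span_pairE)
  have b: "b \<noteq> 0"
  proof
    assume "b = 0"
    then have "s (x + e) \<in> V2.span {s x}" using ab by (simp add: V2.span_base V2.span_scale)
    then show False using n(3) s_span_singleton_iff x by blast
  qed
  have "(inverse b * a) \<odot> s x + s e = inverse b \<odot> s (x + e)"
    using b by (simp add: ab V2.scale_right_distrib)
  then have "(inverse b * a) \<odot> s x + s e \<in> V2.span {s (x + e)}"
    by (simp add: V2.span_base V2.span_scale)
  moreover have "(inverse b * a) \<odot> s x \<in> V2.span {s x}" by (simp add: V2.span_base V2.span_scale)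
  moreover have "y = y'"
    if y: "y \<in> V2.span {s x}" "y + s e \<in> V2.span {s (x + e)}"
      and y': "y' \<in> V2.span {s x}" "y' + s e \<in> V2.span {s (x + e)}" for y y'
  proof (rule ccontr)
    assume "y \<noteq> y'"
    have 1: "y - y' \<in> V2.span {s x}" using y y' V2.span_diff by blast
    have 2: "y - y' \<in> V2.span {s (x + e)}"
      using V2.span_diff[OF y(2) y'(2)] by simp
    have "V2.span {s x} = V2.span {s (x + e)}"
      using V2.span_singleton_eq[OF 1] V2.span_singleton_eq[OF 2] \<open>y \<noteq> y'\<close> by simp
    then have "s (x + e) \<in> V2.span {s x}" by (simp add: V2.span_base)
    then show False using n(3) s_span_singleton_iff x by blast
  qed
  ultimately show ?thesis by blast
qed

lemma partial_lift_in:
  assumes "liftable x"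
  shows "partial_lift x \<in> V2.span {s x}" "partial_lift x + s e \<in> V2.span {s (x + e)}"
  using theI'[OF ex1_partial_lift[OF assms]] unfolding partial_lift_def by blast+

lemma partial_lift_span:
  assumes "liftable x"
  shows "V2.span {partial_lift x} = V2.span {s x}" "V2.span {partial_lift x + s e} = V2.span {s (x + e)}" "partial_lift x \<noteq> 0"
proof -
  have x: "x \<in> X" "x + e \<in> X" "x \<notin> V1.span {e}" using assms by (auto simp: liftable_def)
  note n = V1.notin_span_translate[OF x(3) e_nonzero]
  show l: "partial_lift x \<noteq> 0"
  proof
    assume "partial_lift x = 0"
    then have "s e \<in> V2.span {s (x + e)}" using partial_lift_in[OF assms] by simp
    then show False using n(2) s_span_singleton_iff x e_in by blast
  qed
  show "V2.span {partial_lift x} = V2.span {s x}"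
    using V2.span_singleton_eq[OF partial_lift_in(1)[OF assms] l] .
  have "partial_lift x + s e \<noteq> 0"
  proof
    assume "partial_lift x + s e = 0"
    then have "s e = - partial_lift x" by (simp add: eq_neg_iff_add_eq_0 add.commute)
    then have "s e \<in> V2.span {s x}" using partial_lift_in(1)[OF assms] V2.span_neg by simp
    then show False using n(1) s_span_singleton_iff x e_in by blast
  qed
  then show "V2.span {partial_lift x + s e} = V2.span {s (x + e)}"
    using V2.span_singleton_eq[OF partial_lift_in(2)[OF assms]] by blast
qed

text \<open>
The parallelogram construction: the point of \<open>x + y + e\<close> is the intersection of the line through
\<open>x + e\<close> and \<open>y\<close> with the line through \<open>y + e\<close> and \<open>x\<close>, so its image is spanned by the sum of the
lifts of \<open>x\<close> and \<open>y\<close> and \<open>s e\<close>. As the lift of \<open>x + y\<close> lies in the plane of the lifts of \<open>x\<close> and \<open>y\<close>,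
its normalisation at \<open>x + y + e\<close> determines both coefficients.
\<close>

lemma partial_lift_add_independent:
  assumes g: "liftable x" "liftable y" "liftable (x + y)" and y: "y \<notin> V1.span {x, e}"
  shows "partial_lift (x + y) = partial_lift x + partial_lift y"
proof -
  let ?f = "s e"
  have in_X: "x \<in> X" "x + e \<in> X" "y \<in> X" "y + e \<in> X" "x + y \<in> X" "x + y + e \<in> X"
    using g by (auto simp: liftable_def)
  have f: "?f \<notin> V2.span {partial_lift x}"
    using partial_lift_span(1)[OF g(1)] s_span_singleton_iff in_X(1) e_in
      V1.notin_span_translate(1)[OF _ e_nonzero] g(1) by (auto simp: liftable_def)
  have ly: "partial_lift y \<notin> V2.span {partial_lift x, ?f}"
  proof
    assume "partial_lift y \<in> V2.span {partial_lift x, ?f}"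
    also have "V2.span {partial_lift x, ?f} = V2.span {s x, s e}"
      by (rule V2.span_pair_cong) (simp_all add: partial_lift_span g)
    finally have "V2.span {partial_lift y} \<subseteq> V2.span {s x, s e}" by (intro V2.span_minimal) auto
    then have "s y \<in> V2.span {s x, s e}" using partial_lift_span(1)[OF g(2)] V2.span_base by blast
    then show False using y s_span_iff in_X e_in by blast
  qed
  note coeffs = V2.independent_triple_coeffs[OF partial_lift_span(3)[OF g(1)] f ly]
  have "x + y + e \<in> V1.span {x + e, y}"
    using V1.span_add[of "x + e" "{x + e, y}" y] by (simp add: V1.span_base algebra_simps)
  then have "s (x + y + e) \<in> V2.span {s (x + e), s y}" using s_span_iff in_X by blast
  also have "\<dots> = V2.span {partial_lift x + ?f, partial_lift y}"
    by (rule V2.span_pair_cong) (simp_all add: partial_lift_span g)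
  finally obtain a b where ab: "s (x + y + e) = a \<odot> (partial_lift x + ?f) + b \<odot> partial_lift y"
    by (rule V2.span_pairE)
  have "x + y + e \<in> V1.span {y + e, x}"
    using V1.span_add[of "y + e" "{y + e, x}" x] by (simp add: V1.span_base algebra_simps)
  then have "s (x + y + e) \<in> V2.span {s (y + e), s x}" using s_span_iff in_X by blast
  also have "\<dots> = V2.span {partial_lift y + ?f, partial_lift x}"
    by (rule V2.span_pair_cong) (simp_all add: partial_lift_span g)
  finally obtain c d where cd: "s (x + y + e) = c \<odot> (partial_lift y + ?f) + d \<odot> partial_lift x"
    by (rule V2.span_pairE)
  have "a \<odot> partial_lift x + a \<odot> ?f + b \<odot> partial_lift y = d \<odot> partial_lift x + c \<odot> ?f + c \<odot> partial_lift y"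
    using ab cd by (simp add: V2.scale_right_distrib algebra_simps)
  \<comment> \<open>the two expressions for \<open>s (x + y + e)\<close> are compared in the basis formed by the lifts and \<open>s e\<close>\<close>
  then have "a = c" "b = c" using coeffs by blast+
  then have P: "s (x + y + e) = a \<odot> (partial_lift x + partial_lift y + ?f)"
    using ab by (simp add: V2.scale_right_distrib algebra_simps)
  have "x + y \<in> V1.span {x, y}" by (intro V1.span_add V1.span_base) auto
  then have "s (x + y) \<in> V2.span {s x, s y}" using s_span_iff in_X by blast
  then have "V2.span {s (x + y)} \<subseteq> V2.span {s x, s y}" by (intro V2.span_minimal) auto
  also have "\<dots> = V2.span {partial_lift x, partial_lift y}" by (rule V2.span_pair_cong) (simp_all add: partial_lift_span g)
  finally have "partial_lift (x + y) \<in> V2.span {partial_lift x, partial_lift y}" using partial_lift_in(1)[OF g(3)] by blast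
  then obtain p q where pq: "partial_lift (x + y) = p \<odot> partial_lift x + q \<odot> partial_lift y" by (rule V2.span_pairE)
  obtain r where "partial_lift (x + y) + ?f = r \<odot> s (x + y + e)"
    using partial_lift_in(2)[OF g(3)] by (rule V2.span_singletonE)
  then have "p \<odot> partial_lift x + 1 \<odot> ?f + q \<odot> partial_lift y
      = (r * a) \<odot> partial_lift x + (r * a) \<odot> ?f + (r * a) \<odot> partial_lift y"
    using P pq by (simp add: V2.scale_right_distrib algebra_simps)
  then have "p = r * a" "1 = r * a" "q = r * a" using coeffs by blast+
  then have "p = 1" "q = 1" by simp_all
  then show ?thesis using pq by simp
qed

text \<open>
If \<open>y\<close> lies in the plane of \<open>x\<close> and \<open>e\<close>, a vector \<open>z\<close> outside that plane is added: the three
additions \<open>x + (y + z)\<close>, \<open>y + z\<close> and \<open>(x + y) + z\<close> are all of the independent kind.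
\<close>

lemma partial_lift_add:
  assumes g: "liftable x" "liftable y" "liftable (x + y)"
  shows "partial_lift (x + y) = partial_lift x + partial_lift y"
proof (cases "y \<in> V1.span {x, e}")
  case True
  have xe: "x \<in> V1.span {x, e}" "e \<in> V1.span {x, e}" by (auto intro: V1.span_base)
  then have "x + y \<in> V1.span {x, e}" using True V1.span_add by blast
  then have sub: "V1.span {y, e} \<subseteq> V1.span {x, e}" "V1.span {x + y, e} \<subseteq> V1.span {x, e}"
    "V1.span {e} \<subseteq> V1.span {x, e}"
    using True xe by (intro V1.span_minimal V1.subspace_span; simp)+
  obtain z where z: "\<forall>c\<in>{0, y, x + y, e, y + e, x + y + e}.
      z + c \<notin> V1.span {x, e} \<and> z + c \<notin> V1.span {x, e} \<and> z + c \<in> X"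
    by (rule V1.generic_vector_span[of "{0, y, x + y, e, y + e, x + y + e}" x e x e]) auto
  have gz: "liftable z" "liftable (y + z)" "liftable (x + y + z)"
    using z sub(3) unfolding liftable_def by (auto simp: algebra_simps)
  have "partial_lift (x + (y + z)) = partial_lift x + partial_lift (y + z)"
    using z gz g by (intro partial_lift_add_independent) (auto simp: algebra_simps)
  moreover have "partial_lift (y + z) = partial_lift y + partial_lift z"
    using z gz g sub by (intro partial_lift_add_independent) auto
  moreover have "partial_lift (x + y + z) = partial_lift (x + y) + partial_lift z"
    using z gz g sub by (intro partial_lift_add_independent) auto
  ultimately show ?thesis by (simp add: algebra_simps)
qed (rule partial_lift_add_independent[OF g])

lemma ex_liftable:
  assumes "finite C"
  obtains g where "\<forall>c\<in>C. liftable (g + c) \<and> g + c \<notin> V1.span {x, y}"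
proof -
  obtain g where "\<forall>c\<in>C \<union> (\<lambda>c. c + e) ` C.
      g + c \<notin> V1.span {e, e} \<and> g + c \<notin> V1.span {x, y} \<and> g + c \<in> X"
    by (rule V1.generic_vector_span[of "C \<union> (\<lambda>c. c + e) ` C" e e x y]) (use assms in auto)
  then have "\<forall>c\<in>C. liftable (g + c) \<and> g + c \<notin> V1.span {x, y}"
    unfolding liftable_def by (auto simp: add.assoc)
  then show ?thesis by (rule that)
qed

text \<open>
The difference at any \<open>g\<close> equals the one at an \<open>h\<close> that is generic with respect to it, since
\<open>(g + v) + h = g + (v + h)\<close> can be evaluated by additivity in both ways; one \<open>h\<close> serves \<open>g\<close> and \<open>g'\<close>.
\<close>

lemma partial_lift_difference_eq:
  assumes "liftable g" "liftable (g + v)" "liftable g'" "liftable (g' + v)"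
  shows "partial_lift (g + v) - partial_lift g = partial_lift (g' + v) - partial_lift g'"
proof -
  obtain h where h: "\<forall>c\<in>{0, v, g + v, g' + v}. liftable (h + c) \<and> h + c \<notin> V1.span {e, e}"
    by (rule ex_liftable[of "{0, v, g + v, g' + v}" e e]) auto
  have "partial_lift (k + v) - partial_lift k = partial_lift (h + v) - partial_lift h" if "liftable k" "liftable (k + v)" "k \<in> {g, g'}" for k
  proof -
    have "liftable h" "liftable (h + v)" "liftable (k + v + h)" using h that by (auto simp: algebra_simps)
    then have "partial_lift (k + v + h) = partial_lift (k + v) + partial_lift h" "partial_lift (k + (h + v)) = partial_lift k + partial_lift (h + v)"
      using that by (auto intro!: partial_lift_add simp: algebra_simps)
    then show ?thesis by (simp add: algebra_simps)
  qed
  then show ?thesis using assms by simp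
qed

lemma lift_eq:
  assumes "liftable g" "liftable (g + v)"
  shows "lift v = partial_lift (g + v) - partial_lift g"
proof -
  let ?g = "SOME g. liftable g \<and> liftable (g + v)"
  have "liftable ?g \<and> liftable (?g + v)" using someI[of "\<lambda>g. liftable g \<and> liftable (g + v)" g] assms by blast
  then show ?thesis unfolding lift_def Let_def using partial_lift_difference_eq assms by blast
qed

lemma lift_add: "lift (v + w) = lift v + lift w"
proof -
  obtain g where g: "\<forall>c\<in>{0, v, v + w}. liftable (g + c) \<and> g + c \<notin> V1.span {e, e}"
    by (rule ex_liftable[of "{0, v, v + w}" e e]) auto
  then have "liftable g" "liftable (g + v)" "liftable (g + v + w)" by (auto simp: algebra_simps)
  then have "lift (v + w) = partial_lift (g + v + w) - partial_lift g" "lift v = partial_lift (g + v) - partial_lift g"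
    "lift w = partial_lift (g + v + w) - partial_lift (g + v)"
    using lift_eq by (simp_all add: add.assoc)
  then show ?thesis by simp
qed

text \<open>
As a difference of the partial lifts at \<open>g + x\<close> and \<open>g\<close>, the lift of \<open>x\<close> lies in the plane spanned by
\<open>s x\<close> and \<open>s g\<close>. For \<open>g\<close>, \<open>g'\<close> in general position with respect to \<open>x\<close>, two such planes
meet only in the line of \<open>s x\<close>. Vanishing of the lift would make the images of \<open>g + x\<close> and \<open>g\<close> coincide.
\<close>

lemma lift_on_cone:
  assumes x: "x \<in> X"
  shows "lift x \<in> V2.span {s x}" "lift x \<noteq> 0"
proof -
  have x0: "x \<noteq> 0" using x V1.zero_notin by auto
  have pair: "lift x \<in> V2.span {s x, s g}" if "liftable g" "liftable (g + x)" for g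
  proof -
    have gX: "g \<in> X" "g + x \<in> X" using that by (auto simp: liftable_def)
    have "g + x \<in> V1.span {x, g}" by (intro V1.span_add V1.span_base) auto
    then have "s (g + x) \<in> V2.span {s x, s g}" using s_span_iff x gX by blast
    then have "V2.span {s (g + x)} \<subseteq> V2.span {s x, s g}" by (intro V2.span_minimal) auto
    moreover have "V2.span {s g} \<subseteq> V2.span {s x, s g}" by (intro V2.span_mono) auto
    ultimately show ?thesis
      using lift_eq[OF that] partial_lift_in(1)[OF that(1)] partial_lift_in(1)[OF that(2)]
      by (auto intro: V2.span_diff)
  qed
  obtain g where "\<forall>c\<in>{0, x}. liftable (g + c) \<and> g + c \<notin> V1.span {x, e}"
    by (rule ex_liftable[of "{0, x}" x e]) auto
  then have g: "liftable g" "liftable (g + x)" "g \<notin> V1.span {x, e}" by auto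
  have gx: "g \<notin> V1.span {x}" using g(3) V1.span_mono[of "{x}" "{x, e}"] by auto
  obtain g' where "\<forall>c\<in>{0, x}. liftable (g' + c) \<and> g' + c \<notin> V1.span {x, g}"
    by (rule ex_liftable[of "{0, x}" x g]) auto
  then have g': "liftable g'" "liftable (g' + x)" "g' \<notin> V1.span {x, g}" by auto
  have gX: "g \<in> X" "g' \<in> X" "g + x \<in> X" using g g' by (auto simp: liftable_def)
  show "lift x \<noteq> 0"
  proof
    assume "lift x = 0"
    then have "partial_lift (g + x) = partial_lift g" using lift_eq g by simp
    then have "V2.span {s (g + x)} = V2.span {s g}" using partial_lift_span(1) g by metis
    then have "s (g + x) \<in> V2.span {s g}" using V2.span_base by blast
    then have "g + x \<in> V1.span {g}" using s_span_singleton_iff gX by blast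
    then show False using V1.notin_span_translate(3)[OF gx x0] by blast
  qed
  obtain a b where ab: "lift x = a \<odot> s x + b \<odot> s g"
    using pair[OF g(1,2)] by (rule V2.span_pairE)
  obtain a' b' where ab': "lift x = a' \<odot> s x + b' \<odot> s g'"
    using pair[OF g'(1,2)] by (rule V2.span_pairE)
  have "a \<odot> s x + b \<odot> s g + 0 \<odot> s g' = a' \<odot> s x + 0 \<odot> s g + b' \<odot> s g'" using ab ab' by simp
  moreover have "s g \<notin> V2.span {s x}" "s g' \<notin> V2.span {s x, s g}"
    using s_span_singleton_iff s_span_iff gx g'(3) x gX by simp_all
  ultimately have "b = 0" using V2.independent_triple_coeffs(2)[OF s_nonzero[OF x]] by blast
  then show "lift x \<in> V2.span {s x}" using ab by (simp add: V2.span_base V2.span_scale)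
qed

end

context cone_map
begin

text \<open>
For fixed \<open>a\<close>, the additive map \<open>x \<mapsto> lift (a x)\<close> is proportional to the lift on \<open>X\<close>, because \<open>a x\<close> and \<open>x\<close>
have the same class there; rigidity makes the factor \<open>\<mu> a\<close> independent of \<open>x\<close>.
\<close>

lemma ex_semilinear_lift:
  obtains L \<mu> where "additive L" "\<And>a x. L (a \<cdot> x) = \<mu> a \<odot> L x"
    "\<And>x. x \<in> X \<Longrightarrow> L x \<in> V2.span {s x}" "\<And>x. x \<in> X \<Longrightarrow> L x \<noteq> 0"
proof -
  obtain e where "e \<in> X" using V1.cone_nonempty by auto
  then interpret based_cone_map scl1 X scl2 s e by unfold_locales
  have L: "additive lift" by (simp add: additive_def lift_add)
  have sp: "V2.span {lift x} = V2.span {s x}" if "x \<in> X" for x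
    using V2.span_singleton_eq lift_on_cone that by blast
  have indep: "lift y \<notin> V2.span {lift x}" if "x \<in> X" "y \<in> X" "y \<notin> V1.span {x}" for x y
  proof
    assume "lift y \<in> V2.span {lift x}"
    then have "V2.span {lift y} \<subseteq> V2.span {lift x}" by (intro V2.span_minimal) auto
    then have "s y \<in> V2.span {s x}" using sp that V2.span_base by blast
    then show False using s_span_singleton_iff that by blast
  qed
  have "\<exists>c. \<forall>x. lift (a \<cdot> x) = c \<odot> lift x" for a
  proof (rule V1.proportional_on_cone_imp_proportional)
    show "vector_space scl2" by unfold_locales
    show "additive (\<lambda>x. lift (a \<cdot> x))" by (simp add: additive_def V1.scale_right_distrib lift_add)
    fix x assume x: "x \<in> X"
    show "\<exists>c. lift (a \<cdot> x) = c \<odot> lift x"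
    proof (cases "a = 0")
      case True
      have "lift (a \<cdot> x) = 0 \<odot> lift x" using True additive.zero[OF L] by simp
      then show ?thesis by blast
    next
      case False
      have ax: "a \<cdot> x \<in> X" using V1.scale_in x False by blast
      then have "s (a \<cdot> x) \<in> V2.span {s x}"
        using s_span_singleton_iff x by (simp add: V1.span_base V1.span_scale)
      then have "V2.span {s (a \<cdot> x)} \<subseteq> V2.span {s x}" by (intro V2.span_minimal) auto
      then have "lift (a \<cdot> x) \<in> V2.span {lift x}" using lift_on_cone(1)[OF ax] sp x by blast
      then show ?thesis by (auto elim: V2.span_singletonE)
    qed
  qed (use L lift_on_cone indep in auto)
  then obtain \<mu> where "\<And>a x. lift (a \<cdot> x) = \<mu> a \<odot> lift x" by metis
  then show ?thesis using that L lift_on_cone by blast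
qed

end

section \<open>Points and lines of a projective space\<close>

context vector_space
begin

lemma proj_point_eq_iff:
  assumes "x \<noteq> 0" "y \<noteq> 0"
  shows "proj_point scale x = proj_point scale y \<longleftrightarrow> y \<in> span {x}"
proof
  assume "proj_point scale x = proj_point scale y"
  moreover have "1 \<cdot> y \<in> proj_point scale y" unfolding proj_point_def by (auto intro!: exI[of _ 1])
  ultimately show "y \<in> span {x}" by (auto simp: proj_point_def span_singleton)
next
  assume "y \<in> span {x}"
  then obtain a where a: "y = a \<cdot> x" by (rule span_singletonE)
  then have a0: "a \<noteq> 0" using assms by auto
  have "\<exists>c. c \<noteq> 0 \<and> b \<cdot> x = c \<cdot> y" if "b \<noteq> 0" for b
    using a a0 that by (intro exI[of _ "b * inverse a"]) simp
  moreover have "\<exists>c. c \<noteq> 0 \<and> b \<cdot> y = c \<cdot> x" if "b \<noteq> 0" for b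
    using a a0 that by (intro exI[of _ "b * a"]) simp
  ultimately show "proj_point scale x = proj_point scale y"
    unfolding proj_point_def by blast
qed

lemma proj_point_in_proj_space_iff:
  assumes "subspace W" "x \<noteq> 0"
  shows "proj_point scale x \<in> proj_space scale W \<longleftrightarrow> x \<in> W"
proof
  assume "proj_point scale x \<in> proj_space scale W"
  then obtain y where y: "y \<in> W" "y \<noteq> 0" "proj_point scale x = proj_point scale y"
    by (auto simp: proj_space_def)
  then have "x \<in> span {y}" using proj_point_eq_iff assms(2) by metis
  moreover have "span {y} \<subseteq> W" using y(1) assms(1) by (intro span_minimal) auto
  ultimately show "x \<in> W" by blast
qed (use assms in \<open>auto simp: proj_space_def\<close>)

lemma proj_space_eqD:
  assumes "subspace W" "subspace W'" "proj_space scale W = proj_space scale W'"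
  shows "W = W'"
proof -
  have "x \<in> W \<longleftrightarrow> x \<in> W'" for x
    using proj_point_in_proj_space_iff[of W x] proj_point_in_proj_space_iff[of W' x] assms
      subspace_0 by (cases "x = 0") auto
  then show ?thesis by blast
qed

lemma proj_space_span_pair_in_proj_lines:
  assumes "x \<noteq> 0" "y \<notin> span {x}"
  shows "proj_space scale (span {x, y}) \<in> proj_lines scale"
proof -
  have "independent {x}" using assms(1) independent_insertI[of x "{}"] by simp
  then have "independent {y, x}" using assms(2) independent_insertI by blast
  moreover have "card {y, x} = 2" using assms(2) span_base[of x "{x}"] by (auto simp: card_insert_if)
  ultimately have "dim (span {x, y}) = 2"
    using dim_span_eq_card_independent by (metis insert_commute)
  then show ?thesis unfolding proj_lines_def by blast
qed

lemma proj_linesE: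
  assumes "l \<in> proj_lines scale"
  obtains x y where "x \<noteq> 0" "y \<notin> span {x}" "l = proj_space scale (span {x, y})"
proof -
  obtain W where W: "subspace W" "dim W = 2" "l = proj_space scale W"
    using assms by (auto simp: proj_lines_def)
  obtain B where B: "B \<subseteq> W" "independent B" "W \<subseteq> span B" "card B = 2"
    using basis_exists[of W] W(2) by metis
  obtain x y where xy: "B = {x, y}" "x \<noteq> y" using B(4) by (auto simp: card_2_iff)
  have "x \<noteq> 0" using B(2) dependent_zero xy by blast
  moreover have "y \<notin> span {x}"
  proof
    assume "y \<in> span {x}"
    moreover have "B - {y} = {x}" using xy by auto
    ultimately show False using B(2) xy by (auto simp: dependent_def)
  qed
  moreover have "W = span {x, y}" using B(1,3) W(1) span_minimal xy by blast
  ultimately show ?thesis using that W(3) by blast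
qed

lemma proj_line_through:
  assumes "l \<in> proj_lines scale" "x \<noteq> 0" "y \<notin> span {x}"
    and "proj_point scale x \<in> l" "proj_point scale y \<in> l"
  shows "l = proj_space scale (span {x, y})"
proof -
  obtain u v where l: "l = proj_space scale (span {u, v})" using assms(1) by (rule proj_linesE)
  have "y \<noteq> 0" using assms(3) span_zero by auto
  then have "x \<in> span {u, v}" "y \<in> span {u, v}"
    using assms l by (auto simp: proj_point_in_proj_space_iff)
  then show ?thesis using span_pair_eq assms(2,3) l by simp
qed

end

section \<open>The cone over an ample set\<close>

lemma finite_subset_of_admissible_not_covering:
  assumes "admissible \<S>" "finite \<Z>" "\<Z> \<subseteq> \<S>" "finite P" "P \<subseteq> P1"
  shows "\<exists>p\<in>P1. p \<notin> \<Union>\<Z> \<and> p \<notin> P"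
proof -
  obtain m f where f: "\<Z> = f ` {i. i < (m::nat)}"
    using finite_imp_nat_seg_image_inj_on[OF assms(2)] by blast
  obtain n g where g: "P = g ` {i. i < (n::nat)}"
    using finite_imp_nat_seg_image_inj_on[OF assms(4)] by blast
  have fg: "\<forall>i<m. f i \<in> \<S>" "\<forall>j<n. g j \<in> P1" using assms(3,5) f g by blast+
  have "mn_admissible m n \<S>" using assms(1) by (simp add: admissible_def)
  then have "\<forall>m'\<le>m. \<forall>n'\<le>n. \<forall>S p. (\<forall>i<m'. S i \<in> \<S>) \<and> (\<forall>j<n'. p j \<in> P1) \<longrightarrow>
      (\<Union>i<m'. S i) \<union> {p j | j. j < n'} \<subset> P1"
    unfolding mn_admissible_def by (rule conjunct2)
  from spec[OF this, of m, THEN mp, OF order_refl]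
  have "\<forall>n'\<le>n. \<forall>S p. (\<forall>i<m. S i \<in> \<S>) \<and> (\<forall>j<n'. p j \<in> P1) \<longrightarrow>
      (\<Union>i<m. S i) \<union> {p j | j. j < n'} \<subset> P1" .
  from spec[OF spec[OF spec[OF this, of n, THEN mp, OF order_refl], of f], of g, THEN mp, OF conjI[OF fg]]
  have "(\<Union>i<m. f i) \<union> {g j | j. j < n} \<subset> P1" .
  moreover have "(\<Union>i<m. f i) = \<Union>\<Z>" "{g j | j. j < n} = P" using f g by auto
  ultimately have "\<Union>\<Z> \<union> P \<subset> P1" by simp
  from psubset_imp_ex_mem[OF this] show ?thesis by auto
qed

text \<open>
In the basis \<open>p, q\<close> of the plane, \<open>q + t p\<close> has coordinates \<open>(t, 1)\<close>; the matrix is the inverse of the one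
with columns \<open>p\<close> and \<open>q\<close>, and the hypothesis says that its determinant does not vanish.
\<close>

lemma ex_PGL2_normalizing:
  fixes p q :: "'k::field ^ 2"
  assumes "p $ 1 * q $ 2 - p $ 2 * q $ 1 \<noteq> 0"
  shows "\<exists>A :: 'k ^ 2 ^ 2. invertible A \<and> (\<forall>t. A *v (q + t *s p) = vector [t, 1])"
proof -
  define D where "D = p $ 1 * q $ 2 - p $ 2 * q $ 1"
  have D: "D \<noteq> 0" using assms by (simp add: D_def)
  define A :: "'k ^ 2 ^ 2"
    where "A = vector [vector [q $ 2 / D, - q $ 1 / D], vector [- p $ 2 / D, p $ 1 / D]]"
  define B :: "'k ^ 2 ^ 2" where "B = vector [vector [p $ 1, q $ 1], vector [p $ 2, q $ 2]]"
  have D': "p $ 1 * q $ 2 = D + p $ 2 * q $ 1" by (simp add: D_def)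
  have "A ** B = mat 1" "B ** A = mat 1"
    using D by (simp_all add: A_def B_def vec_eq_iff forall_2 matrix_matrix_mult_def sum_2 mat_def
        field_simps D')
  then have "invertible A" unfolding invertible_def by blast
  moreover have "A *v (q + t *s p) = vector [t, 1]" for t
    using D by (simp add: A_def vec_eq_iff forall_2 matrix_vector_mult_def sum_2 field_simps D')
  ultimately show ?thesis by metis
qed

lemma proj_point_matrix_image:
  fixes A :: "'k::field ^ 2 ^ 2"
  shows "(*v) A ` proj_point (*s) x = proj_point (*s) (A *v x)"
  by (auto simp: proj_point_def image_iff vector_scalar_commute) (metis vector_scalar_commute)

context vector_space
begin

text \<open>
The complement of \<open>U\<close> on the projective line spanned by \<open>u\<close> and \<open>v\<close> is a member of \<open>\<S>\<close> in some coordinate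
\<open>\<beta>\<close>. Stability under \<open>PGL\<^sub>2\<close> permits changing \<open>\<beta>\<close> to the coordinate in which \<open>v + t u\<close> becomes the
point \<open>(t : 1)\<close>. For different \<open>v\<close> the exceptional sets thus live on one and the same \<open>\<P>\<^sup>1\<close>, as is necessary
to apply admissibility to their union.
\<close>

lemma ample_affine_line:
  assumes stable: "PGL2_stable \<S>" and ample: "ample \<S> scale U"
    and u: "u \<noteq> 0" "proj_point scale u \<in> U" and v: "v \<notin> span {u}"
  shows "\<exists>Z\<in>\<S>. \<forall>t. proj_point scale (v + t \<cdot> u) \<notin> U \<longrightarrow> proj_point (*s) (vector [t, 1]) \<in> Z"
proof -
  define l where "l = proj_space scale (span {u, v})"
  have l: "l \<in> proj_lines scale" unfolding l_def by (rule proj_space_span_pair_in_proj_lines[OF u(1) v])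
  have uv: "u \<in> span {u, v}" "v \<in> span {u, v}" "v \<noteq> 0"
    using v span_zero by (auto intro: span_base)
  have "proj_point scale u \<in> l \<inter> U" using u uv by (simp add: l_def proj_point_in_proj_space_iff)
  then have "l - U \<in> transport \<S> scale l" using l ample unfolding ample_def by blast
  then obtain W \<beta> where W: "subspace W" "l = proj_space scale W" and \<beta>S: "\<beta> ` (l - U) \<in> \<S>"
    and "proj_iso scale W (*s) UNIV \<beta>"
    unfolding transport_def by auto
  then obtain f where f0: "bij_betw f W UNIV" "\<forall>x\<in>W. \<forall>y\<in>W. f (x + y) = f x + f y"
      "\<forall>a. \<forall>x\<in>W. f (a \<cdot> x) = a *s f x"
      "\<forall>x\<in>W - {0}. \<beta> (proj_point scale x) = proj_point (*s) (f x)"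
    unfolding proj_iso_def by auto
  note f = f0(1) f0(2)[rule_format] f0(3)[rule_format] and \<beta> = f0(4)[rule_format]
  have uvW: "u \<in> W" "v \<in> W"
    using W proj_space_eqD[OF subspace_span W(1)] uv unfolding l_def by auto
  have line_in: "v + t \<cdot> u \<in> W" for t using uvW W(1) subspace_add subspace_scale by blast
  have comb: "f (a \<cdot> u + b \<cdot> v) = a *s f u + b *s f v" for a b
    using f(2,3) uvW W(1) subspace_scale by simp
  have indep: "a = 0 \<and> b = 0" if "a *s f u + b *s f v = 0" for a b
  proof -
    have "f (a \<cdot> u + b \<cdot> v) = f (0 \<cdot> u + 0 \<cdot> v)" using that by (simp only: comb) simp
    moreover have "a \<cdot> u + b \<cdot> v \<in> W" "0 \<cdot> u + 0 \<cdot> v \<in> W"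
      using uvW W(1) subspace_add subspace_scale by blast+
    ultimately have "a \<cdot> u + b \<cdot> v = 0 \<cdot> u + 0 \<cdot> v"
      using f(1) unfolding bij_betw_def inj_on_def by blast
    then show ?thesis using independent_pair_coeffs[OF u(1) v] by blast
  qed
  have "f u $ 1 * f v $ 2 - f u $ 2 * f v $ 1 \<noteq> 0"
  proof
    assume D: "f u $ 1 * f v $ 2 - f u $ 2 * f v $ 1 = 0"
    then have "f v $ 2 *s f u + (- (f u $ 2)) *s f v = 0" "(- (f v $ 1)) *s f u + f u $ 1 *s f v = 0"
      by (simp_all add: vec_eq_iff forall_2 algebra_simps)
    then have "f u $ 2 = 0" "f u $ 1 = 0"
      using indep[of "f v $ 2" "- (f u $ 2)"] indep[of "- (f v $ 1)" "f u $ 1"] by simp_all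
    then have "1 *s f u + 0 *s f v = 0" by (simp add: vec_eq_iff forall_2)
    then show False using indep[of 1 0] by simp
  qed
  then obtain A :: "'a ^ 2 ^ 2" where A: "invertible A" "\<And>t. A *v (f v + t *s f u) = vector [t, 1]"
    using ex_PGL2_normalizing by blast
  have "(`) ((*v) A) \<in> PGL2" using A(1) unfolding PGL2_def by blast
  then have "(`) ((*v) A) ` \<beta> ` (l - U) \<in> \<S>" using stable \<beta>S unfolding PGL2_stable_def by blast
  moreover have "proj_point (*s) (vector [t, 1]) \<in> (`) ((*v) A) ` \<beta> ` (l - U)"
    if "proj_point scale (v + t \<cdot> u) \<notin> U" for t
  proof -
    have "v + t \<cdot> u \<noteq> 0"
    proof
      assume "v + t \<cdot> u = 0"
      then have "v = (- t) \<cdot> u" by (simp add: eq_neg_iff_add_eq_0)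
      then show False using v by (metis span_base span_scale singletonI)
    qed
    then have "proj_point scale (v + t \<cdot> u) \<in> l - U" "\<beta> (proj_point scale (v + t \<cdot> u)) = proj_point (*s) (f (v + t \<cdot> u))"
      using that W line_in \<beta> by (simp_all add: proj_point_in_proj_space_iff)
    moreover have "f (v + t \<cdot> u) = f v + t *s f u" using f uvW W(1) subspace_scale by simp
    then have "(*v) A ` proj_point (*s) (f (v + t \<cdot> u)) = proj_point (*s) (vector [t, 1])"
      by (simp add: proj_point_matrix_image A)
    ultimately show ?thesis by (metis imageI)
  qed
  ultimately show ?thesis by blast
qed

text \<open>
The point of \<open>\<P>\<^sup>1\<close> provided by admissibility avoids the exceptional sets of all \<open>v\<close>, the
forbidden parameters and also \<open>(1 : 0)\<close>, so that it has the form \<open>(t : 1)\<close>.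
\<close>

lemma ample_generic_translate:
  assumes adm: "admissible \<S>" and ample: "ample \<S> scale U"
    and F: "finite F" and T: "finite T" and u: "u \<noteq> 0" "proj_point scale u \<in> U"
  shows "\<exists>t. t \<notin> T \<and> (\<forall>v\<in>F. v + t \<cdot> u \<noteq> 0 \<and> proj_point scale (v + t \<cdot> u) \<in> U)"
proof -
  have stable: "PGL2_stable \<S>" using adm unfolding admissible_def mn_admissible_def by blast
  let ?pt = "\<lambda>t. proj_point (*s) (vector [t, 1] :: 'a ^ 2)"
  let ?inf = "proj_point (*s) (vector [1, 0] :: 'a ^ 2)"
  obtain Z where Z: "\<And>v. v \<notin> span {u} \<Longrightarrow> Z v \<in> \<S>"
      "\<And>v t. v \<notin> span {u} \<Longrightarrow> proj_point scale (v + t \<cdot> u) \<notin> U \<Longrightarrow> ?pt t \<in> Z v"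
    using ample_affine_line[OF stable ample u] by metis
  \<comment> \<open>besides \<open>T\<close>, the parameter at which the translate of a multiple of \<open>u\<close> vanishes has to be avoided\<close>
  define T' where "T' = T \<union> (\<Union>v\<in>F. {t. v + t \<cdot> u \<in> {0}})"
  have T': "finite T'"
    unfolding T'_def using F T u(1) finite_line_inter_subspace[OF subspace_single_0] by simp
  have nz: "(vector [a, b] :: 'a ^ 2) \<noteq> 0" if "a \<noteq> 0 \<or> b \<noteq> 0" for a b
    using that by (auto simp: vec_eq_iff forall_2)
  have P1I: "proj_point (*s) x \<in> P1" if "x \<noteq> 0" for x :: "'a ^ 2"
    using that by (simp add: P1_def proj_space_def)
  have "\<exists>p\<in>P1. p \<notin> \<Union>(Z ` (F - span {u})) \<and> p \<notin> insert ?inf (?pt ` T')"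
    by (rule finite_subset_of_admissible_not_covering[OF adm]) (use F T' Z(1) nz P1I in auto)
  then obtain x :: "'a ^ 2" where x: "x \<noteq> 0" "proj_point (*s) x \<notin> \<Union>(Z ` (F - span {u}))"
      "proj_point (*s) x \<noteq> ?inf" "proj_point (*s) x \<notin> ?pt ` T'"
    by (auto simp: P1_def proj_space_def)
  have "x $ 2 \<noteq> 0"
  proof
    assume "x $ 2 = 0"
    then have "x = x $ 1 *s vector [1, 0]" by (simp add: vec_eq_iff forall_2)
    then have "x \<in> vec.span {vector [1, 0]}" by (metis vec.span_base vec.span_scale singletonI)
    moreover have "(vector [1, 0] :: 'a ^ 2) \<noteq> 0" by (rule nz) simp
    ultimately show False using x(1,3) vec.proj_point_eq_iff[of "vector [1, 0]" x] by simp
  qed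
  define t where "t = x $ 1 / x $ 2"
  have "x = x $ 2 *s vector [t, 1]" using \<open>x $ 2 \<noteq> 0\<close> by (simp add: vec_eq_iff forall_2 t_def)
  then have "x \<in> vec.span {vector [t, 1]}" by (metis vec.span_base vec.span_scale singletonI)
  moreover have "(vector [t, 1] :: 'a ^ 2) \<noteq> 0" by (rule nz) simp
  ultimately have pt: "?pt t = proj_point (*s) x"
    using vec.proj_point_eq_iff[of "vector [t, 1]" x] x(1) by simp
  then have t: "t \<notin> T'" using x(4) by (auto simp: pt[symmetric])
  have "v + t \<cdot> u \<noteq> 0 \<and> proj_point scale (v + t \<cdot> u) \<in> U" if v: "v \<in> F" for v
  proof
    show nz: "v + t \<cdot> u \<noteq> 0" using t v by (auto simp: T'_def)
    show "proj_point scale (v + t \<cdot> u) \<in> U"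
    proof (cases "v \<in> span {u}")
      case True
      then have "v + t \<cdot> u \<in> span {u}" by (simp add: span_add span_base span_scale)
      then show ?thesis using proj_point_eq_iff[OF u(1) nz] u(2) by simp
    next
      case False
      then show ?thesis using Z(2)[OF False, of t] x(2) pt v by auto
    qed
  qed
  then show ?thesis using t by (auto simp: T'_def)
qed

lemma ample_cone_of_ample:
  assumes "dim_ge scale 3" "admissible \<S>" "ample \<S> scale U"
  shows "ample_cone scale {x. x \<noteq> 0 \<and> proj_point scale x \<in> U}"
proof unfold_locales
  show "a \<cdot> x \<in> {x. x \<noteq> 0 \<and> proj_point scale x \<in> U}"
    if "x \<in> {x. x \<noteq> 0 \<and> proj_point scale x \<in> U}" "a \<noteq> 0" for x a
    using that proj_point_eq_iff[of x "a \<cdot> x"] by (auto simp: span_base span_scale)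
  show "{x. x \<noteq> 0 \<and> proj_point scale x \<in> U} \<noteq> {}"
    using assms(3) unfolding ample_def proj_space_def by blast
  show "\<exists>v. v \<notin> span {x, y}" for x y using dim_ge_3_imp_ex_notin_span_pair[OF assms(1)] .
  show "\<exists>t. t \<notin> T \<and> (\<forall>v\<in>F. v + t \<cdot> u \<in> {x. x \<noteq> 0 \<and> proj_point scale x \<in> U})"
    if "finite F" "finite T" "u \<in> {x. x \<noteq> 0 \<and> proj_point scale x \<in> U}" for F T u
    using ample_generic_translate[OF assms(2,3) that(1,2), of u] that(3) by auto
qed auto

text \<open>
A translate in the direction of the given point \<open>x\<close> of \<open>U\<close> moves any other point of the line into \<open>U\<close>
without leaving the line. Hence \<open>\<tau>\<close> is determined by \<open>\<sigma>\<close> on lines meeting \<open>U\<close>.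
\<close>

lemma proj_line_through_two_cone_points:
  assumes cone: "ample_cone scale {x. x \<noteq> 0 \<and> proj_point scale x \<in> U}" and U: "U \<subseteq> proj_space scale UNIV"
    and l: "l \<in> proj_lines_meeting scale U"
  obtains x y where "x \<noteq> 0" "y \<noteq> 0" "proj_point scale x \<in> U" "proj_point scale y \<in> U"
    "y \<notin> span {x}" "l = proj_space scale (span {x, y})"
proof -
  interpret ample_cone scale "{x. x \<noteq> 0 \<and> proj_point scale x \<in> U}" by fact
  have ll: "l \<in> proj_lines scale" "l \<inter> U \<noteq> {}" using l by (auto simp: proj_lines_meeting_def)
  then obtain x where x: "x \<noteq> 0" "proj_point scale x \<in> U" "proj_point scale x \<in> l"
    using U by (auto simp: proj_space_def)
  obtain u v where uv: "u \<noteq> 0" "v \<notin> span {u}" "l = proj_space scale (span {u, v})"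
    using ll(1) by (rule proj_linesE)
  have x_in: "x \<in> span {u, v}" using x uv by (simp add: proj_point_in_proj_space_iff)
  obtain w where w: "w \<in> span {u, v}" "w \<notin> span {x}"
  proof (cases "u \<in> span {x}")
    case True
    then have "v \<notin> span {x}" using span_singleton_eq[of u x] uv(1,2) by simp
    then show ?thesis using that[of v] by (simp add: span_base)
  next
    case False
    then show ?thesis using that[of u] by (simp add: span_base)
  qed
  obtain t where t: "w + t \<cdot> x \<noteq> 0" "proj_point scale (w + t \<cdot> x) \<in> U"
    using generic_translate[of "{w}" "{}" x] x by auto
  have tx: "t \<cdot> x \<in> span {x}" by (simp add: span_base span_scale)
  have n: "w + t \<cdot> x \<notin> span {x}" using w(2) span_add_eq2[OF tx] by simp
  have "w + t \<cdot> x \<in> span {u, v}" using w(1) x_in span_add span_scale by simp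
  then have "proj_point scale (w + t \<cdot> x) \<in> l" using t uv(3) by (simp add: proj_point_in_proj_space_iff)
  then have "l = proj_space scale (span {x, w + t \<cdot> x})"
    using proj_line_through[OF ll(1) x(1) n x(3)] by simp
  then show ?thesis using that[of x "w + t \<cdot> x"] x t n by simp
qed

end

section \<open>Collineations induced by semilinear bijections\<close>

text \<open>
Through every point there are two distinct lines meeting \<open>U\<close>. Both collineations send these lines to the
same lines, and therefore agree at their intersection.
\<close>

lemma collineation_extension_unique:
  assumes cone: "ample_cone scl1 {x. x \<noteq> 0 \<and> proj_point scl1 x \<in> U}"
    and c': "collineation scl1 scl2 \<sigma>' \<tau>'" "extends scl1 U \<sigma> \<tau> \<sigma>' \<tau>'"
    and c'': "collineation scl1 scl2 \<sigma>'' \<tau>''" "extends scl1 U \<sigma> \<tau> \<sigma>'' \<tau>''"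
  shows "\<forall>p\<in>proj_space scl1 UNIV. \<sigma>'' p = \<sigma>' p" "\<forall>l\<in>proj_lines scl1. \<tau>'' l = \<tau>' l"
proof -
  interpret V: ample_cone scl1 "{x. x \<noteq> 0 \<and> proj_point scl1 x \<in> U}" by fact
  have pt: "proj_point scl1 x \<in> proj_space scl1 UNIV" if "x \<noteq> 0" for x
    using that by (simp add: proj_space_def)
  have sub: "l \<subseteq> proj_space scl1 UNIV" if "l \<in> proj_lines scl1" for l
    using that by (auto simp: proj_lines_def proj_space_def)
  have inj: "inj_on \<sigma>' (proj_space scl1 UNIV)" using c'(1) by (simp add: collineation_def bij_betw_def)
  have same_line: "\<sigma>'' ` l = \<sigma>' ` l" if "l \<in> proj_lines scl1" "l \<inter> U \<noteq> {}" for l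
  proof -
    have "l \<in> proj_lines_meeting scl1 U" using that by (simp add: proj_lines_meeting_def)
    then have "\<tau>'' l = \<tau>' l" using c' c'' by (simp add: extends_def)
    then show ?thesis using c' c'' that by (simp add: collineation_def)
  qed
  have eq: "\<sigma>'' (proj_point scl1 x) = \<sigma>' (proj_point scl1 x)" if x: "x \<noteq> 0" for x
  proof -
    have on_line: "\<exists>z. z \<noteq> 0 \<and> z \<in> V.span {x, g} \<and> \<sigma>'' (proj_point scl1 x) = \<sigma>' (proj_point scl1 z)"
      if g: "g \<noteq> 0" "proj_point scl1 g \<in> U" "g \<notin> V.span {x}" for g
    proof -
      let ?l = "proj_space scl1 (V.span {x, g})"
      have l: "?l \<in> proj_lines scl1" by (rule V.proj_space_span_pair_in_proj_lines[OF x g(3)])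
      have "proj_point scl1 x \<in> ?l" "proj_point scl1 g \<in> ?l"
        using x g by (simp_all add: V.proj_point_in_proj_space_iff V.span_base)
      then have "\<sigma>'' (proj_point scl1 x) \<in> \<sigma>' ` ?l" using same_line[OF l] g(2) by blast
      then show ?thesis by (auto simp: proj_space_def)
    qed
    obtain g where g: "g \<noteq> 0" "proj_point scl1 g \<in> U" "g \<notin> V.span {x}"
      using V.generic_vector_span[of "{0}" x x x x] by auto
    obtain g' where g': "g' \<noteq> 0" "proj_point scl1 g' \<in> U" "g' \<notin> V.span {x, g}"
      using V.generic_vector_span[of "{0}" x g x g] by auto
    have g'x: "g' \<notin> V.span {x}" using g'(3) V.span_mono[of "{x}" "{x, g}"] by auto
    obtain z where z: "z \<noteq> 0" "z \<in> V.span {x, g}"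
        "\<sigma>'' (proj_point scl1 x) = \<sigma>' (proj_point scl1 z)"
      using on_line[OF g] by auto
    obtain z' where z': "z' \<noteq> 0" "z' \<in> V.span {x, g'}"
        "\<sigma>'' (proj_point scl1 x) = \<sigma>' (proj_point scl1 z')"
      using on_line[OF g'(1,2) g'x] by auto
    have "proj_point scl1 z' = proj_point scl1 z"
      using inj_onD[OF inj, of "proj_point scl1 z'" "proj_point scl1 z"] z z' pt by simp
    then have "z \<in> V.span {z'}" using V.proj_point_eq_iff z z' by blast
    moreover have "V.span {z'} \<subseteq> V.span {x, g'}" using z'(2) by (intro V.span_minimal) auto
    ultimately have "z \<in> V.span {x, g'}" by blast
    then obtain a b where ab: "z = scl1 a x + scl1 b g'" by (rule V.span_pairE)
    obtain c d where cd: "z = scl1 c x + scl1 d g" using z(2) by (rule V.span_pairE)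
    have "scl1 c x + scl1 d g + scl1 0 g' = scl1 a x + scl1 0 g + scl1 b g'" using ab cd by simp
    then have "d = 0" using V.independent_triple_coeffs(2)[OF x g(3) g'(3)] by blast
    then have "z \<in> V.span {x}" using cd by (simp add: V.span_base V.span_scale)
    then show ?thesis using z(3) V.proj_point_eq_iff[OF x z(1)] by simp
  qed
  then show p: "\<forall>p\<in>proj_space scl1 UNIV. \<sigma>'' p = \<sigma>' p" by (auto simp: proj_space_def)
  show "\<forall>l\<in>proj_lines scl1. \<tau>'' l = \<tau>' l"
  proof
    fix l assume l: "l \<in> proj_lines scl1"
    have "\<sigma>'' ` l = \<sigma>' ` l" using p sub[OF l] by (intro image_cong) auto
    then show "\<tau>'' l = \<tau>' l" using c' c'' l by (simp add: collineation_def)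
  qed
qed

text \<open>
Since points are sets of vectors and lines are sets of points, the collineation induced by \<open>h\<close> is
given by taking images, once on points and twice on lines.
\<close>

locale semilinear_bijection = V1: vector_space scl1 + V2: vector_space scl2
  for scl1 :: "'k1::field \<Rightarrow> 'v1::ab_group_add \<Rightarrow> 'v1" (infixr "\<cdot>" 75)
    and scl2 :: "'k2::field \<Rightarrow> 'v2::ab_group_add \<Rightarrow> 'v2" (infixr "\<odot>" 75) +
  fixes \<mu> :: "'k1 \<Rightarrow> 'k2" and h :: "'v1 \<Rightarrow> 'v2"
  assumes semilinear: "semilinear_iso scl1 scl2 \<mu> h"
begin

lemma h_add: "h (x + y) = h x + h y" and h_scale: "h (a \<cdot> x) = \<mu> a \<odot> h x" and bij_h: "bij h" and bij_\<mu>: "bij \<mu>"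
  and \<mu>_add: "\<mu> (a + b) = \<mu> a + \<mu> b"
  using semilinear by (simp_all add: semilinear_iso_def field_iso_def)

lemma additive_h: "additive h"
  by (simp add: additive_def h_add)

lemma h_eq_0_iff: "h x = 0 \<longleftrightarrow> x = 0"
  using additive.zero[OF additive_h] bij_h by (metis bij_def injD)

lemma \<mu>_eq_0_iff: "\<mu> a = 0 \<longleftrightarrow> a = 0"
  using additive.zero[of \<mu>] bij_\<mu> by (metis additive_def \<mu>_add bij_def injD)

lemma h_image_span_pair: "h ` V1.span {x, y} = V2.span {h x, h y}"
proof (intro equalityI subsetI)
  fix z assume "z \<in> V2.span {h x, h y}"
  then obtain a b where "z = a \<odot> h x + b \<odot> h y" by (rule V2.span_pairE)
  moreover obtain a' b' where "a = \<mu> a'" "b = \<mu> b'" using bij_\<mu> by (metis bij_pointE)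
  ultimately have "z = h (a' \<cdot> x + b' \<cdot> y)" by (simp add: h_add h_scale)
  then show "z \<in> h ` V1.span {x, y}" using V1.in_span_pair by blast
qed (auto elim!: V1.span_pairE simp: h_add h_scale V2.in_span_pair)

lemma h_in_span_singleton_iff: "h y \<in> V2.span {h x} \<longleftrightarrow> y \<in> V1.span {x}"
  using h_image_span_pair[of x x] bij_h by (metis bij_def inj_image_mem_iff insert_absorb2)

lemma h_image_proj_point: "h ` proj_point scl1 x = proj_point scl2 (h x)"
proof (intro equalityI subsetI)
  fix z assume "z \<in> proj_point scl2 (h x)"
  then obtain a where "z = a \<odot> h x" "a \<noteq> 0" by (auto simp: proj_point_def)
  moreover obtain a' where "a = \<mu> a'" using bij_\<mu> by (metis bij_pointE)
  ultimately have "z = h (a' \<cdot> x)" "a' \<noteq> 0" using \<mu>_eq_0_iff by (auto simp: h_scale)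
  then show "z \<in> h ` proj_point scl1 x" by (auto simp: proj_point_def)
qed (auto simp: proj_point_def h_scale \<mu>_eq_0_iff)

lemma h_image_proj_space: "(`) h ` proj_space scl1 W = proj_space scl2 (h ` W)"
proof -
  have "h ` W - {0} = h ` (W - {0})" by (auto simp: h_eq_0_iff)
  then show ?thesis by (simp add: proj_space_def image_image h_image_proj_point)
qed

lemma collineation_h: "collineation scl1 scl2 ((`) h) ((`) ((`) h))"
proof -
  have i: "inj ((`) h)" using bij_h by (simp add: bij_def inj_def inj_image_eq_iff)
  then have ii: "inj ((`) ((`) h))" by (simp add: inj_def[of "(`) ((`) h)"] inj_image_eq_iff)
  have "(`) ((`) h) ` proj_lines scl1 = proj_lines scl2"
  proof (intro equalityI subsetI)
    fix m assume "m \<in> (`) ((`) h) ` proj_lines scl1"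
    then obtain l where l: "l \<in> proj_lines scl1" "m = (`) h ` l" by auto
    obtain x y where xy: "x \<noteq> 0" "y \<notin> V1.span {x}" "l = proj_space scl1 (V1.span {x, y})"
      using l(1) by (rule V1.proj_linesE)
    have "m = proj_space scl2 (V2.span {h x, h y})"
      using l xy by (simp add: h_image_proj_space h_image_span_pair)
    then show "m \<in> proj_lines scl2"
      using V2.proj_space_span_pair_in_proj_lines[of "h x" "h y"] xy
      by (simp add: h_eq_0_iff h_in_span_singleton_iff)
  next
    fix m assume "m \<in> proj_lines scl2"
    then obtain u v where uv: "u \<noteq> 0" "v \<notin> V2.span {u}" "m = proj_space scl2 (V2.span {u, v})"
      by (rule V2.proj_linesE)
    obtain x y where xy: "u = h x" "v = h y" using bij_h by (metis bij_pointE)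
    have "m = (`) h ` proj_space scl1 (V1.span {x, y})"
      using uv xy by (simp add: h_image_proj_space h_image_span_pair)
    moreover have "proj_space scl1 (V1.span {x, y}) \<in> proj_lines scl1"
      using V1.proj_space_span_pair_in_proj_lines[of x y] uv xy
      by (simp add: h_eq_0_iff h_in_span_singleton_iff)
    ultimately show "m \<in> (`) ((`) h) ` proj_lines scl1" by blast
  qed
  moreover have "(`) h ` proj_space scl1 UNIV = proj_space scl2 UNIV"
    using bij_h by (simp add: h_image_proj_space bij_def)
  ultimately show ?thesis
    by (simp add: collineation_def bij_betw_def inj_on_subset[OF i] inj_on_subset[OF ii])
qed

lemma extends_h:
  assumes cone: "ample_cone scl1 {x. x \<noteq> 0 \<and> proj_point scl1 x \<in> U1}"
    and U1: "U1 \<subseteq> proj_space scl1 UNIV"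
    and \<tau>: "\<forall>l\<in>proj_lines_meeting scl1 U1. \<tau> l \<in> proj_lines scl2 \<and> \<tau> l \<inter> U2 = \<sigma> ` (l \<inter> U1)"
    and \<sigma>: "\<And>x. x \<noteq> 0 \<Longrightarrow> proj_point scl1 x \<in> U1 \<Longrightarrow> \<sigma> (proj_point scl1 x) = proj_point scl2 (h x)"
  shows "extends scl1 U1 \<sigma> \<tau> ((`) h) ((`) ((`) h))"
  unfolding extends_def
proof (intro conjI ballI)
  show "h ` p = \<sigma> p" if p: "p \<in> U1" for p
  proof -
    obtain x where "x \<noteq> 0" "p = proj_point scl1 x" using U1 p by (auto simp: proj_space_def)
    then show ?thesis using \<sigma> p by (simp add: h_image_proj_point)
  qed
  fix l assume l: "l \<in> proj_lines_meeting scl1 U1"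
  obtain x y where xy: "x \<noteq> 0" "y \<noteq> 0" "proj_point scl1 x \<in> U1" "proj_point scl1 y \<in> U1"
    "y \<notin> V1.span {x}" "l = proj_space scl1 (V1.span {x, y})"
    using cone U1 l by (rule V1.proj_line_through_two_cone_points)
  have "proj_point scl1 x \<in> l \<inter> U1" "proj_point scl1 y \<in> l \<inter> U1"
    using xy by (simp_all add: V1.proj_point_in_proj_space_iff V1.span_base)
  then have "\<sigma> (proj_point scl1 x) \<in> \<tau> l" "\<sigma> (proj_point scl1 y) \<in> \<tau> l" using bspec[OF \<tau> l] by blast+
  then have "\<tau> l = proj_space scl2 (V2.span {h x, h y})"
    using V2.proj_line_through[of "\<tau> l" "h x" "h y"] bspec[OF \<tau> l] \<sigma> xy
    by (simp add: h_eq_0_iff h_in_span_singleton_iff)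
  then show "(`) h ` l = \<tau> l" using xy(6) by (simp add: h_image_proj_space h_image_span_pair)
qed

end

section \<open>Lifting and uniqueness\<close>

text \<open>
If \<open>x\<close> and \<open>y\<close> span a line \<open>l\<close>, then \<open>\<tau> l\<close> is the line spanned by \<open>s x\<close> and \<open>s y\<close>; its points in \<open>U2\<close> are
the images of the points of \<open>l\<close> in \<open>U1\<close>, which by injectivity of \<open>\<sigma>\<close> is the hypothesis of
\<open>cone_map\<close>. The lemma serves for \<open>(\<sigma>, \<tau>)\<close> and for the inverse pair.
\<close>

lemma ex_semilinear_map_inducing:
  assumes vs2: "vector_space scl2"
    and cone: "ample_cone scl1 {x. x \<noteq> 0 \<and> proj_point scl1 x \<in> U1}"
    and U2: "U2 \<subseteq> proj_space scl2 UNIV" and \<sigma>: "bij_betw \<sigma> U1 U2"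
    and \<tau>: "\<forall>l\<in>proj_lines_meeting scl1 U1. \<tau> l \<in> proj_lines scl2 \<and> \<tau> l \<inter> U2 = \<sigma> ` (l \<inter> U1)"
  shows "\<exists>L \<mu>. additive L \<and> (\<forall>a x. L (scl1 a x) = scl2 (\<mu> a) (L x)) \<and>
    (\<forall>x. x \<noteq> 0 \<longrightarrow> proj_point scl1 x \<in> U1 \<longrightarrow> L x \<noteq> 0 \<and> \<sigma> (proj_point scl1 x) = proj_point scl2 (L x))"
proof -
  let ?X = "{x. x \<noteq> 0 \<and> proj_point scl1 x \<in> U1}"
  interpret V1: ample_cone scl1 ?X by fact
  interpret V2: vector_space scl2 by fact
  have "\<exists>y. y \<noteq> 0 \<and> \<sigma> (proj_point scl1 x) = proj_point scl2 y" if "x \<in> ?X" for x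
  proof -
    have "\<sigma> (proj_point scl1 x) \<in> U2" using that \<sigma> by (auto simp: bij_betw_def)
    then show ?thesis using U2 by (auto simp: proj_space_def)
  qed
  then obtain s where s: "\<And>x. x \<in> ?X \<Longrightarrow> s x \<noteq> 0 \<and> \<sigma> (proj_point scl1 x) = proj_point scl2 (s x)"
    by metis
  have inj: "\<sigma> p = \<sigma> q \<longleftrightarrow> p = q" if "p \<in> U1" "q \<in> U1" for p q
    using \<sigma> that by (auto simp: bij_betw_def inj_on_def)
  have single: "s z \<in> V2.span {s x} \<longleftrightarrow> z \<in> V1.span {x}" if "x \<in> ?X" "z \<in> ?X" for x z
    using V2.proj_point_eq_iff[of "s x" "s z"] V1.proj_point_eq_iff[of x z] s[OF that(1)] s[OF that(2)]
      inj[of "proj_point scl1 x" "proj_point scl1 z"] that by auto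
  interpret cone_map scl1 ?X scl2 s
  proof unfold_locales
    fix x y z assume x: "x \<in> ?X" and y: "y \<in> ?X" and z: "z \<in> ?X"
    show "s z \<in> V2.span {s x, s y} \<longleftrightarrow> z \<in> V1.span {x, y}"
    proof (cases "y \<in> V1.span {x}")
      case True
      then have "s y \<in> V2.span {s x}" using single x y by blast
      then have "V2.span {s x, s y} = V2.span {s x, s x}"
        using V2.span_singleton_eq s[OF y] by (intro V2.span_pair_cong) auto
      moreover have "V1.span {x, y} = V1.span {x, x}"
        using V1.span_singleton_eq[OF True] y by (intro V1.span_pair_cong) auto
      ultimately show ?thesis using single x z by simp
    next
      case False
      define l where "l = proj_space scl1 (V1.span {x, y})"
      have l: "l \<in> proj_lines scl1"
        unfolding l_def using V1.proj_space_span_pair_in_proj_lines[OF _ False] x by simp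
      have in_l: "proj_point scl1 w \<in> l \<longleftrightarrow> w \<in> V1.span {x, y}" if "w \<in> ?X" for w
        unfolding l_def using V1.proj_point_in_proj_space_iff that by simp
      have "proj_point scl1 x \<in> l" "proj_point scl1 y \<in> l" using in_l x y V1.span_base by simp_all
      then have meet: "l \<in> proj_lines_meeting scl1 U1" using l x by (auto simp: proj_lines_meeting_def)
      have in_\<tau>l: "proj_point scl2 (s w) \<in> \<tau> l \<longleftrightarrow> w \<in> V1.span {x, y}" if w: "w \<in> ?X" for w
      proof -
        have "\<sigma> (proj_point scl1 w) \<in> U2" using w \<sigma> by (auto simp: bij_betw_def)
        then have "proj_point scl2 (s w) \<in> \<tau> l \<longleftrightarrow> \<sigma> (proj_point scl1 w) \<in> \<sigma> ` (l \<inter> U1)"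
          using bspec[OF \<tau> meet] s[OF w] by auto
        also have "\<dots> \<longleftrightarrow> proj_point scl1 w \<in> l" using inj w by auto
        finally show ?thesis using in_l[OF w] by simp
      qed
      have "s y \<notin> V2.span {s x}" using single x y False by blast
      moreover have "proj_point scl2 (s x) \<in> \<tau> l" "proj_point scl2 (s y) \<in> \<tau> l"
        using in_\<tau>l[OF x] in_\<tau>l[OF y] by (simp_all add: V1.span_base)
      ultimately have "\<tau> l = proj_space scl2 (V2.span {s x, s y})"
        using V2.proj_line_through bspec[OF \<tau> meet] s[OF x] by simp
      then show ?thesis using in_\<tau>l[OF z] V2.proj_point_in_proj_space_iff s[OF z] by simp
    qed
  qed (use s in auto)
  obtain L \<mu> where L: "additive L" "\<And>a x. L (scl1 a x) = scl2 (\<mu> a) (L x)"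
    "\<And>x. x \<in> ?X \<Longrightarrow> L x \<in> V2.span {s x}" "\<And>x. x \<in> ?X \<Longrightarrow> L x \<noteq> 0"
    by (rule ex_semilinear_lift) blast
  show ?thesis
  proof (intro exI conjI allI impI)
    show "additive L" "L (scl1 a x) = scl2 (\<mu> a) (L x)" for a x using L by simp_all
    fix x assume "x \<noteq> 0" "proj_point scl1 x \<in> U1"
    then have x: "x \<in> ?X" by simp
    show "L x \<noteq> 0" "\<sigma> (proj_point scl1 x) = proj_point scl2 (L x)"
      using V2.proj_point_eq_iff[of "s x" "L x"] s[OF x] L(3,4)[OF x] by simp_all
  qed
qed

text \<open>
Intended for the composite of a lift of \<open>\<sigma>\<close> with a lift of \<open>\<sigma>\<^sup>-\<^sup>1\<close>: it fixes the points of \<open>U\<close>, so it is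
pointwise proportional to the identity on the cone.
\<close>

lemma inducing_maps_compose_to_scalar:
  assumes vs: "vector_space scl"
    and cone: "ample_cone scl {x. x \<noteq> 0 \<and> proj_point scl x \<in> U}"
    and M: "additive M" "\<And>x. x \<noteq> 0 \<Longrightarrow> proj_point scl x \<in> U \<Longrightarrow> M x \<noteq> 0 \<and> proj_point scl (M x) = proj_point scl x"
  obtains c where "c \<noteq> 0" "\<And>x. M x = scl c x"
proof -
  let ?X = "{x. x \<noteq> 0 \<and> proj_point scl x \<in> U}"
  interpret ample_cone scl ?X by fact
  have "\<exists>c. \<forall>x. M x = scl c x"
  proof (rule proportional_on_cone_imp_proportional[OF vs _ M(1)])
    show "additive (\<lambda>x. x)" by (simp add: additive_def)
    show "\<exists>c. M x = scl c x" if "x \<in> ?X" for x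
      using proj_point_eq_iff[of x "M x"] M(2)[of x] that by (auto elim: span_singletonE)
  qed auto
  then obtain c where c: "\<And>x. M x = scl c x" by blast
  obtain x where "x \<noteq> 0" "proj_point scl x \<in> U" using cone_nonempty by auto
  then have "c \<noteq> 0" using M(2)[of x] c[of x] by auto
  then show ?thesis using c that by blast
qed

text \<open>
The properties of \<open>\<mu>\<close> are read off at a single vector \<open>x0\<close>. Its surjectivity comes from the other side:
\<open>L'\<close> does not distinguish \<open>b L x0\<close> from \<open>L (\<mu>' b x0)\<close>, which gives \<open>\<mu> (\<mu>' b) = b\<close>.
\<close>

lemma semilinear_iso_of_mutually_inverse_up_to_scalar:
  fixes scl1 :: "'k1::field \<Rightarrow> 'v1::ab_group_add \<Rightarrow> 'v1"
    and scl2 :: "'k2::field \<Rightarrow> 'v2::ab_group_add \<Rightarrow> 'v2" and x0 :: 'v1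
  assumes vs1: "vector_space scl1" and vs2: "vector_space scl2"
    and L: "additive L" "\<And>a x. L (scl1 a x) = scl2 (\<mu> a) (L x)"
    and L': "\<And>b y. L' (scl2 b y) = scl1 (\<mu>' b) (L' y)"
    and c: "c \<noteq> 0" "\<And>x. L' (L x) = scl1 c x" and c': "c' \<noteq> 0" "\<And>y. L (L' y) = scl2 c' y"
    and nontrivial: "x0 \<noteq> 0"
  shows "semilinear_iso scl1 scl2 \<mu> L"
proof -
  interpret V1: vector_space scl1 by fact
  interpret V2: vector_space scl2 by fact
  have inj: "x = y" if "L x = L y" for x y using c that by (metis V1.scale_cancel_left)
  have inj': "x = y" if "L' x = L' y" for x y using c' that by (metis V2.scale_cancel_left)
  have "y = L (L' (scl2 (inverse c') y))" for y using c' by simp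
  then have "bij L" using inj unfolding bij_def inj_def surj_def by blast
  have L0: "L x0 \<noteq> 0" using inj[of x0 0] additive.zero[OF L(1)] nontrivial by auto
  have cancel: "a = b" if "scl2 a (L x0) = scl2 b (L x0)" for a b
    using that L0 by (simp add: V2.scale_cancel_right)
  have "\<mu> 1 = 1" using L(2)[of 1 x0] by (intro cancel) simp
  moreover have "\<mu> (a + b) = \<mu> a + \<mu> b" for a b
    using L(2)[of "a + b" x0] additive.add[OF L(1)]
    by (intro cancel) (simp add: V1.scale_left_distrib V2.scale_left_distrib L(2))
  moreover have "\<mu> (a * b) = \<mu> a * \<mu> b" for a b
    using L(2)[of "a * b" x0] L(2)[of a "scl1 b x0"] L(2)[of b x0] by (intro cancel) simp
  moreover have "a = b" if "\<mu> a = \<mu> b" for a b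
  proof -
    have "L (scl1 a x0) = L (scl1 b x0)" using L(2) that by simp
    then have "scl1 a x0 = scl1 b x0" by (rule inj)
    then show ?thesis using nontrivial V1.scale_cancel_right by blast
  qed
  moreover have "b = \<mu> (\<mu>' b)" for b
  proof -
    have "L' (scl2 b (L x0)) = L' (L (scl1 (\<mu>' b) x0))" using L' c(2) by (simp add: mult.commute)
    then have "scl2 b (L x0) = L (scl1 (\<mu>' b) x0)" by (rule inj')
    then have "scl2 b (L x0) = scl2 (\<mu> (\<mu>' b)) (L x0)" unfolding L(2) .
    then show ?thesis by (rule cancel)
  qed
  ultimately have "field_iso \<mu>" unfolding field_iso_def bij_def inj_def surj_def by blast
  then show ?thesis using \<open>bij L\<close> L additive.add[OF L(1)] by (simp add: semilinear_iso_def)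
qed

text \<open>
The two induced collineations coincide by \<open>collineation_extension_unique\<close>, so \<open>h\<close> and \<open>h'\<close> are pointwise
proportional and hence \<open>h' = c h\<close>; the scalar is carried back to the source along \<open>\<mu>\<close>.
\<close>

lemma semilinear_iso_unique_up_to_scalar:
  assumes vs2: "vector_space scl2"
    and cone: "ample_cone scl1 {x. x \<noteq> 0 \<and> proj_point scl1 x \<in> U1}"
    and h: "semilinear_iso scl1 scl2 \<mu> h" "induces scl1 scl2 U1 h \<sigma> \<tau>"
    and h': "semilinear_iso scl1 scl2 \<mu>' h'" "induces scl1 scl2 U1 h' \<sigma> \<tau>"
  shows "\<mu>' = \<mu> \<and> (\<exists>a. a \<noteq> 0 \<and> (\<forall>x. h' x = h (scl1 a x)))"
proof -
  let ?X = "{x. x \<noteq> 0 \<and> proj_point scl1 x \<in> U1}"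
  interpret V1: ample_cone scl1 ?X by fact
  interpret V2: vector_space scl2 by fact
  interpret h: semilinear_bijection scl1 scl2 \<mu> h by unfold_locales fact
  interpret h': semilinear_bijection scl1 scl2 \<mu>' h' by unfold_locales fact
  obtain \<sigma>1 \<tau>1 where 1: "collineation scl1 scl2 \<sigma>1 \<tau>1" "extends scl1 U1 \<sigma> \<tau> \<sigma>1 \<tau>1"
      "\<And>x. x \<noteq> 0 \<Longrightarrow> \<sigma>1 (proj_point scl1 x) = proj_point scl2 (h x)"
    using h(2) unfolding induces_def by auto
  obtain \<sigma>2 \<tau>2 where 2: "collineation scl1 scl2 \<sigma>2 \<tau>2" "extends scl1 U1 \<sigma> \<tau> \<sigma>2 \<tau>2"
      "\<And>x. x \<noteq> 0 \<Longrightarrow> \<sigma>2 (proj_point scl1 x) = proj_point scl2 (h' x)"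
    using h'(2) unfolding induces_def by auto
  have pt: "proj_point scl2 (h' x) = proj_point scl2 (h x)" if "x \<noteq> 0" for x
  proof -
    have "proj_point scl1 x \<in> proj_space scl1 UNIV" using that by (simp add: proj_space_def)
    then have "\<sigma>2 (proj_point scl1 x) = \<sigma>1 (proj_point scl1 x)"
      using collineation_extension_unique(1)[OF cone 1(1,2) 2(1,2)] by blast
    then show ?thesis using 1(3) 2(3) that by simp
  qed
  have "\<exists>c. \<forall>x. h' x = scl2 c (h x)"
  proof (rule V1.proportional_on_cone_imp_proportional[OF vs2 h.additive_h h'.additive_h])
    show "\<exists>c. h' x = scl2 c (h x)" if "x \<in> ?X" for x
      using V2.proj_point_eq_iff[of "h x" "h' x"] pt[of x] that
      by (auto simp: h.h_eq_0_iff h'.h_eq_0_iff elim: V2.span_singletonE)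
  qed (auto simp: h.h_eq_0_iff h.h_in_span_singleton_iff)
  then obtain c where c: "\<And>x. h' x = scl2 c (h x)" by blast
  obtain x where "x \<in> ?X" using V1.cone_nonempty by blast
  then have x: "x \<noteq> 0" by simp
  have c0: "c \<noteq> 0"
  proof
    assume "c = 0"
    then have "h' x = 0" using c[of x] by simp
    then show False using h'.h_eq_0_iff[of x] x by blast
  qed
  obtain a where a: "c = \<mu> a" using h.bij_\<mu> by (metis bij_pointE)
  have "\<mu>' b = \<mu> b" for b
  proof -
    have "scl2 (\<mu>' b * c) (h x) = scl2 (\<mu>' b) (h' x)" by (simp add: c)
    also have "\<dots> = h' (scl1 b x)" by (rule h'.h_scale[symmetric])
    also have "\<dots> = scl2 (c * \<mu> b) (h x)" by (simp add: c h.h_scale)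
    finally have "\<mu>' b * c = c * \<mu> b"
      using V2.scale_cancel_right[of "\<mu>' b * c" "h x" "c * \<mu> b"] h.h_eq_0_iff[of x] x by blast
    then show ?thesis using c0 by simp
  qed
  then have "\<mu>' = \<mu>" by blast
  moreover have "a \<noteq> 0" using c0 a h.\<mu>_eq_0_iff by simp
  moreover have "h' x = h (scl1 a x)" for x using c a h.h_scale by simp
  ultimately show ?thesis by blast
qed

section \<open>The extension theorem\<close>

theorem theoremE:
  fixes scale1 :: "'k1::field \<Rightarrow> 'v1::ab_group_add \<Rightarrow> 'v1"
    and scale2 :: "'k2::field \<Rightarrow> 'v2::ab_group_add \<Rightarrow> 'v2"
    and \<S>1 :: "('k1 ^ 2) set set set" and \<S>2 :: "('k2 ^ 2) set set set"
    and U1 :: "'v1 set set" and U2 :: "'v2 set set"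
    and \<sigma> :: "'v1 set \<Rightarrow> 'v2 set" and \<tau> :: "'v1 set set \<Rightarrow> 'v2 set set"
  assumes "vector_space scale1" and "vector_space scale2"
    and "dim_ge scale1 3" and "dim_ge scale2 3"
    and "admissible \<S>1" and "admissible \<S>2"
    and "ample \<S>1 scale1 U1" and "ample \<S>2 scale2 U2"
    and "bij_betw \<sigma> U1 U2"
    and "bij_betw \<tau> (proj_lines_meeting scale1 U1) (proj_lines_meeting scale2 U2)"
    and "\<forall>l\<in>proj_lines_meeting scale1 U1. \<tau> l \<inter> U2 = \<sigma> ` (l \<inter> U1)"
  shows "(\<exists>\<sigma>' \<tau>'. collineation scale1 scale2 \<sigma>' \<tau>' \<and> extends scale1 U1 \<sigma> \<tau> \<sigma>' \<tau>' \<and>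
            (\<forall>\<sigma>'' \<tau>''. collineation scale1 scale2 \<sigma>'' \<tau>'' \<and> extends scale1 U1 \<sigma> \<tau> \<sigma>'' \<tau>'' \<longrightarrow>
               (\<forall>p\<in>proj_space scale1 UNIV. \<sigma>'' p = \<sigma>' p) \<and>
               (\<forall>l\<in>proj_lines scale1. \<tau>'' l = \<tau>' l)))
       \<and> (\<exists>\<mu> h. semilinear_iso scale1 scale2 \<mu> h \<and> induces scale1 scale2 U1 h \<sigma> \<tau>)
       \<and> (\<forall>\<mu> h \<mu>' h'.
            semilinear_iso scale1 scale2 \<mu> h \<and> induces scale1 scale2 U1 h \<sigma> \<tau> \<and>
            semilinear_iso scale1 scale2 \<mu>' h' \<and> induces scale1 scale2 U1 h' \<sigma> \<tau> \<longrightarrow>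
            \<mu>' = \<mu> \<and> (\<exists>a. a \<noteq> 0 \<and> (\<forall>x. h' x = h (scale1 a x))))"
proof -
  let ?X1 = "{x. x \<noteq> 0 \<and> proj_point scale1 x \<in> U1}"
  let ?X2 = "{x. x \<noteq> 0 \<and> proj_point scale2 x \<in> U2}"
  note vs1 = assms(1) and vs2 = assms(2) and \<sigma> = assms(9) and \<tau> = assms(10) and compat = assms(11)
  have cone1: "ample_cone scale1 ?X1"
    using vector_space.ample_cone_of_ample[OF vs1 assms(3,5,7)] .
  have cone2: "ample_cone scale2 ?X2"
    using vector_space.ample_cone_of_ample[OF vs2 assms(4,6,8)] .
  have U: "U1 \<subseteq> proj_space scale1 UNIV" "U2 \<subseteq> proj_space scale2 UNIV"
    using assms(7,8) by (simp_all add: ample_def)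
  define \<sigma>i where "\<sigma>i = the_inv_into U1 \<sigma>"
  define \<tau>i where "\<tau>i = the_inv_into (proj_lines_meeting scale1 U1) \<tau>"
  have \<sigma>i: "bij_betw \<sigma>i U2 U1" "\<And>p. p \<in> U1 \<Longrightarrow> \<sigma>i (\<sigma> p) = p" "\<And>q. q \<in> U2 \<Longrightarrow> \<sigma> (\<sigma>i q) = q"
    unfolding \<sigma>i_def using bij_betw_the_inv_into[OF \<sigma>] f_the_inv_into_f_bij_betw[OF \<sigma>]
      the_inv_into_f_f[OF bij_betw_imp_inj_on[OF \<sigma>]] by simp_all
  have \<tau>': "\<forall>l\<in>proj_lines_meeting scale1 U1. \<tau> l \<in> proj_lines scale2 \<and> \<tau> l \<inter> U2 = \<sigma> ` (l \<inter> U1)"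
    using bij_betwE[OF \<tau>] compat by (auto simp: proj_lines_meeting_def)
  have \<tau>i': "\<forall>m\<in>proj_lines_meeting scale2 U2. \<tau>i m \<in> proj_lines scale1 \<and> \<tau>i m \<inter> U1 = \<sigma>i ` (m \<inter> U2)"
  proof
    fix m assume m: "m \<in> proj_lines_meeting scale2 U2"
    have l: "\<tau>i m \<in> proj_lines_meeting scale1 U1"
      using bij_betwE[OF bij_betw_the_inv_into[OF \<tau>]] m unfolding \<tau>i_def by blast
    have "\<tau> (\<tau>i m) = m"
      unfolding \<tau>i_def using f_the_inv_into_f_bij_betw[OF \<tau>] m by simp
    then have "m \<inter> U2 = \<sigma> ` (\<tau>i m \<inter> U1)" using bspec[OF \<tau>' l] by simp
    then have "\<sigma>i ` (m \<inter> U2) = (\<lambda>p. \<sigma>i (\<sigma> p)) ` (\<tau>i m \<inter> U1)" by (simp add: image_image)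
    also have "\<dots> = \<tau>i m \<inter> U1" using \<sigma>i(2) by auto
    finally show "\<tau>i m \<in> proj_lines scale1 \<and> \<tau>i m \<inter> U1 = \<sigma>i ` (m \<inter> U2)"
      using l by (simp add: proj_lines_meeting_def)
  qed
  obtain h \<mu> where h0: "additive h" "\<forall>a x. h (scale1 a x) = scale2 (\<mu> a) (h x)"
    "\<forall>x. x \<noteq> 0 \<longrightarrow> proj_point scale1 x \<in> U1 \<longrightarrow>
      h x \<noteq> 0 \<and> \<sigma> (proj_point scale1 x) = proj_point scale2 (h x)"
    using ex_semilinear_map_inducing[OF vs2 cone1 U(2) \<sigma> \<tau>'] by (elim exE conjE)
  note h = h0(1) h0(2,3)[rule_format]
  obtain h' \<mu>' where h'0: "additive h'" "\<forall>a x. h' (scale2 a x) = scale1 (\<mu>' a) (h' x)"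
    "\<forall>x. x \<noteq> 0 \<longrightarrow> proj_point scale2 x \<in> U2 \<longrightarrow>
      h' x \<noteq> 0 \<and> \<sigma>i (proj_point scale2 x) = proj_point scale1 (h' x)"
    using ex_semilinear_map_inducing[OF vs1 cone2 U(1) \<sigma>i(1) \<tau>i'] by (elim exE conjE)
  note h' = h'0(1) h'0(2,3)[rule_format]
  have \<sigma>_in: "\<sigma> p \<in> U2" if "p \<in> U1" for p using bij_betwE[OF \<sigma>] that by blast
  have \<sigma>i_in: "\<sigma>i q \<in> U1" if "q \<in> U2" for q using bij_betwE[OF \<sigma>i(1)] that by blast
  have h'h: "h' (h x) \<noteq> 0 \<and> proj_point scale1 (h' (h x)) = proj_point scale1 x"
    if "x \<noteq> 0" "proj_point scale1 x \<in> U1" for x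
    using h(3)[OF that] h'(3)[of "h x"] \<sigma>_in[OF that(2)] \<sigma>i(2)[OF that(2)] by simp
  have hh': "h (h' y) \<noteq> 0 \<and> proj_point scale2 (h (h' y)) = proj_point scale2 y"
    if "y \<noteq> 0" "proj_point scale2 y \<in> U2" for y
    using h'(3)[OF that] h(3)[of "h' y"] \<sigma>i_in[OF that(2)] \<sigma>i(3)[OF that(2)] by simp
  have "additive (\<lambda>x. h' (h x))" "additive (\<lambda>y. h (h' y))"
    using h(1) h'(1) by (simp_all add: additive_def)
  note add = this
  obtain c where c: "c \<noteq> 0" "\<And>x. h' (h x) = scale1 c x"
    using inducing_maps_compose_to_scalar[OF vs1 cone1 add(1) h'h] by blast
  obtain c' where c': "c' \<noteq> 0" "\<And>y. h (h' y) = scale2 c' y"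
    using inducing_maps_compose_to_scalar[OF vs2 cone2 add(2) hh'] by blast
  obtain x0 where "x0 \<in> ?X1" using ample_cone.cone_nonempty[OF cone1] by blast
  then have "x0 \<noteq> 0" by simp
  then have iso: "semilinear_iso scale1 scale2 \<mu> h"
    using semilinear_iso_of_mutually_inverse_up_to_scalar[OF vs1 vs2 h(1,2) h'(2) c c'] by blast
  then interpret semilinear_bijection scale1 scale2 \<mu> h
    using vs1 vs2 by (simp add: semilinear_bijection_def semilinear_bijection_axioms_def)
  have ext: "extends scale1 U1 \<sigma> \<tau> ((`) h) ((`) ((`) h))"
    using extends_h[OF cone1 U(1) \<tau>'] h(3) by blast
  have "(\<forall>p\<in>proj_space scale1 UNIV. \<sigma>'' p = h ` p) \<and> (\<forall>l\<in>proj_lines scale1. \<tau>'' l = (`) h ` l)"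
    if c: "collineation scale1 scale2 \<sigma>'' \<tau>'' \<and> extends scale1 U1 \<sigma> \<tau> \<sigma>'' \<tau>''" for \<sigma>'' \<tau>''
    using collineation_extension_unique[OF cone1 collineation_h ext conjunct1[OF c] conjunct2[OF c]]
    by (rule conjI)
  then have extension: "\<exists>\<sigma>' \<tau>'. collineation scale1 scale2 \<sigma>' \<tau>' \<and> extends scale1 U1 \<sigma> \<tau> \<sigma>' \<tau>' \<and>
      (\<forall>\<sigma>'' \<tau>''. collineation scale1 scale2 \<sigma>'' \<tau>'' \<and> extends scale1 U1 \<sigma> \<tau> \<sigma>'' \<tau>'' \<longrightarrow>
         (\<forall>p\<in>proj_space scale1 UNIV. \<sigma>'' p = \<sigma>' p) \<and> (\<forall>l\<in>proj_lines scale1. \<tau>'' l = \<tau>' l))"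
    using collineation_h ext by (intro exI[of _ "(`) h"] exI[of _ "(`) ((`) h)"] conjI allI impI) blast+
  have "induces scale1 scale2 U1 h \<sigma> \<tau>"
    unfolding induces_def using collineation_h ext h_image_proj_point
    by (intro exI[of _ "(`) h"] exI[of _ "(`) ((`) h)"]) simp
  then have existence: "\<exists>\<mu> h. semilinear_iso scale1 scale2 \<mu> h \<and> induces scale1 scale2 U1 h \<sigma> \<tau>"
    using iso by blast
  have "\<forall>\<mu> h \<mu>' h'.
      semilinear_iso scale1 scale2 \<mu> h \<and> induces scale1 scale2 U1 h \<sigma> \<tau> \<and>
      semilinear_iso scale1 scale2 \<mu>' h' \<and> induces scale1 scale2 U1 h' \<sigma> \<tau> \<longrightarrow>
      \<mu>' = \<mu> \<and> (\<exists>a. a \<noteq> 0 \<and> (\<forall>x. h' x = h (scale1 a x)))"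
    using semilinear_iso_unique_up_to_scalar[OF vs2 cone1] by (intro allI impI) (elim conjE)
  with extension existence show ?thesis by (intro conjI)
qed

end
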